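(* Let $F:[0,\infty)\to\mathcal{L}(\mathfrak{H})$ be a measurable family of non-negative self-adjoint contractions on a Hilbert space $\mathfrak{H}$ such that $F(0)=\mathds{1}$. For $\tau>0$ put $S(\tau):=(\mathds{1}-F(\tau))/\tau$, and let $H\ge0$ be a self-adjoint operator in $\mathfrak{H}$ such that $\operatorname{s-lim}_{\tau\to+0}(\mathds{1}+S(\tau))^{-1}=(\mathds{1}+H)^{-1}$. Then $$\lim_{n\to\infty}\sup_{t\in\mathcal{I}}\|F(t/n)^n-e^{-tH}\|=0$$ for any closed interval $\mathcal{I}=[a,b]$ with $0<a<b<\infty$, if and only if $$\lim_{\tau\to+0}\|(\mathds{1}+S(\tau))^{-1}-(\mathds{1}+H)^{-1}\|=0.$$
   Context: $\mathcal{L}(\mathfrak{H})$ is the space of bounded linear operators on $\mathfrak{H}$, $\|\cdot\|$ is the operator norm, $\mathds{1}$ is the identity operator, and $\operatorname{s-lim}$ denotes the limit in the strong operator topology. *)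

theory Defs
  imports "HOL-Analysis.Analysis"
begin

text \<open>
  A complex Hilbert space is a type that is a real Hilbert space for
  \<open>inner x y = Re (cinner x y)\<close>. The two structures share \<open>norm x = sqrt (inner x x)\<close>, so that
  limits, completeness, bounded operators \<open>'a \<Rightarrow>\<^sub>L 'a\<close> and the operator norm come from the library.
  \<open>cinner\<close> is antilinear in its first and linear in its second argument. The remaining axioms of
  an inner product (additivity in the second argument, definiteness) follow from those listed.
\<close>

class complex_hilbert = real_inner + complete_space +
  fixes scaleC :: "complex \<Rightarrow> 'a \<Rightarrow> 'a"  (infixr "*\<^sub>C" 75)
    and cinner :: "'a \<Rightarrow> 'a \<Rightarrow> complex"
  assumes scaleC_add_right: "a *\<^sub>C (x + y) = a *\<^sub>C x + a *\<^sub>C y"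
    and scaleC_add_left: "(a + b) *\<^sub>C x = a *\<^sub>C x + b *\<^sub>C x"
    and scaleC_scaleC: "a *\<^sub>C b *\<^sub>C x = (a * b) *\<^sub>C x"
    and scaleC_of_real: "complex_of_real r *\<^sub>C x = r *\<^sub>R x"
    and cinner_commute: "cinner x y = cnj (cinner y x)"
    and cinner_add_left: "cinner (x + y) z = cinner x z + cinner y z"
    and cinner_scaleC_right: "cinner x (a *\<^sub>C y) = a * cinner x y"
    and Re_cinner: "Re (cinner x y) = inner x y"

instantiation complex :: complex_hilbert
begin

definition "scaleC a (x::complex) = a * x"
definition "cinner x (y::complex) = cnj x * y"

instance
  by standard (auto simp: scaleC_complex_def cinner_complex_def algebra_simps
      scaleR_conv_of_real inner_complex_def)

end

text \<open>The space \<open>\<L>(H)\<close>: real-linear bounded operators that are moreover complex-linear.\<close>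

definition bounded_ops :: "('a::complex_hilbert \<Rightarrow>\<^sub>L 'a) set" where
  "bounded_ops = {T. \<forall>c x. blinfun_apply T (c *\<^sub>C x) = c *\<^sub>C blinfun_apply T x}"

definition blinfun_pow :: "('a::real_normed_vector \<Rightarrow>\<^sub>L 'a) \<Rightarrow> nat \<Rightarrow> ('a \<Rightarrow>\<^sub>L 'a)" where
  "blinfun_pow T n = ((\<lambda>R. T o\<^sub>L R) ^^ n) id_blinfun"

text \<open>
  A possibly unbounded operator is identified with its graph \<open>{(x, A x) |x. x \<in> dom A}\<close>, so that
  equality of operators includes equality of the domains.
\<close>

type_synonym 'a operator = "('a \<times> 'a) set"

definition linear_operator :: "'a::complex_hilbert operator \<Rightarrow> bool" where
  "linear_operator A \<longleftrightarrow> single_valued A \<and> (0, 0) \<in> A \<and>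
     (\<forall>x y x' y'. (x, y) \<in> A \<longrightarrow> (x', y') \<in> A \<longrightarrow> (x + x', y + y') \<in> A) \<and>
     (\<forall>c x y. (x, y) \<in> A \<longrightarrow> (c *\<^sub>C x, c *\<^sub>C y) \<in> A)"

definition densely_defined :: "'a::complex_hilbert operator \<Rightarrow> bool" where
  "densely_defined A \<longleftrightarrow> closure (Domain A) = UNIV"

definition adjoint_op :: "'a::complex_hilbert operator \<Rightarrow> 'a operator" where
  "adjoint_op A = {(y, z). \<forall>(x, w)\<in>A. cinner y w = cinner z x}"

definition self_adjoint :: "'a::complex_hilbert operator \<Rightarrow> bool" where
  "self_adjoint A \<longleftrightarrow> linear_operator A \<and> densely_defined A \<and> adjoint_op A = A"

definition nonneg_op :: "'a::complex_hilbert operator \<Rightarrow> bool" where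
  "nonneg_op A \<longleftrightarrow> (\<forall>(x, y)\<in>A. cinner x y \<in> \<real>\<^sub>\<ge>\<^sub>0)"

definition op_graph :: "('a::complex_hilbert \<Rightarrow>\<^sub>L 'a) \<Rightarrow> 'a operator" where
  "op_graph T = {(x, blinfun_apply T x) |x. True}"

definition uminus_op :: "'a::complex_hilbert operator \<Rightarrow> 'a operator" where
  "uminus_op A = {(x, - y) |x y. (x, y) \<in> A}"

definition one_plus_op :: "'a::complex_hilbert operator \<Rightarrow> 'a operator" where
  "one_plus_op A = {(x, x + y) |x y. (x, y) \<in> A}"

text \<open>
  The inverse \<open>A\<inverse>\<close> of a bijection \<open>A : dom A \<rightarrow> H\<close> with bounded inverse. A bounded operator is
  determined by its graph, so there is at most one such \<open>R\<close>.
\<close>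

definition inverse_op :: "'a::complex_hilbert operator \<Rightarrow> ('a \<Rightarrow>\<^sub>L 'a)" where
  "inverse_op A = (THE R. R \<in> bounded_ops \<and> op_graph R = A\<inverse>)"

text \<open>Strongly continuous one-parameter semigroups; only the values for \<open>t \<ge> 0\<close> matter.\<close>

definition C0_semigroup :: "(real \<Rightarrow> ('a::complex_hilbert \<Rightarrow>\<^sub>L 'a)) \<Rightarrow> bool" where
  "C0_semigroup U \<longleftrightarrow> (\<forall>t\<ge>0. U t \<in> bounded_ops) \<and> U 0 = id_blinfun \<and>
     (\<forall>s\<ge>0. \<forall>t\<ge>0. U (s + t) = U s o\<^sub>L U t) \<and>
     limitin strong_operator_topology U id_blinfun (at_right 0)"

definition generator :: "(real \<Rightarrow> ('a::complex_hilbert \<Rightarrow>\<^sub>L 'a)) \<Rightarrow> 'a operator" where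
  "generator U = {(x, y). ((\<lambda>h. (blinfun_apply (U h) x - x) /\<^sub>R h) \<longlongrightarrow> y) (at_right 0)}"

text \<open>
  \<open>exp_op A t\<close> is \<open>e\<^sup>t\<^sup>A\<close> for \<open>t \<ge> 0\<close>: the value at \<open>t\<close> of the strongly continuous semigroup
  generated by \<open>A\<close>. The description is of the value and not of \<open>U\<close>, because \<open>U\<close> is
  unconstrained at negative times.
\<close>

definition exp_op :: "'a::complex_hilbert operator \<Rightarrow> real \<Rightarrow> ('a \<Rightarrow>\<^sub>L 'a)" where
  "exp_op A t = (THE T. \<exists>U. C0_semigroup U \<and> generator U = A \<and> T = U t)"

text \<open>Measurability of an operator-valued function in the weak sense, i.e. of all its matrix elements.\<close>

definition weakly_measurable :: "real set \<Rightarrow> (real \<Rightarrow> ('a::complex_hilbert \<Rightarrow>\<^sub>L 'a)) \<Rightarrow> bool" where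
  "weakly_measurable I F \<longleftrightarrow>
     (\<forall>x y. (\<lambda>t. cinner x (blinfun_apply (F t) y)) \<in> borel_measurable (lebesgue_on I))"

definition S_op :: "(real \<Rightarrow> ('a::complex_hilbert \<Rightarrow>\<^sub>L 'a)) \<Rightarrow> real \<Rightarrow> ('a \<Rightarrow>\<^sub>L 'a)" where
  "S_op F \<tau> = (id_blinfun - F \<tau>) /\<^sub>R \<tau>"

end

theory Submission
  imports Defs "HOL-Real_Asymp.Real_Asymp"
begin

text \<open>
  Everything is expressed by continuous functions of the resolvents \<open>R\<^sub>\<tau> = (1 + S \<tau>)\<inverse>\<close> and
  \<open>R = (1 + H)\<inverse>\<close>, which are self-adjoint operators between 0 and 1. With
  \<open>heat_fun t r = exp (- t (1 / r - 1))\<close>, extended by 0 to \<open>r = 0\<close>, one has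
  \<open>exp (- t H) = heat_fun t R\<close> and \<open>exp (- t S \<tau>) = heat_fun t R\<^sub>\<tau>\<close>.

  The powers of \<open>F\<close> are compared with exponentials by a Chernoff estimate. For
  \<open>0 \<le> x \<le> 1\<close> the numbers \<open>x\<^sup>n\<close> and \<open>exp (- n (1 - x))\<close> differ by at most \<open>6 / n\<close>, so
  \<open>F(t/n)\<^sup>n\<close> and \<open>exp (- t S(t/n))\<close> differ in norm by at most \<open>6 / n\<close>
  (\<open>blinfun_pow_heat_dist_le\<close>), whatever \<open>t > 0\<close> is. The theorem thus compares convergence of
  \<open>heat_fun t R\<^sub>\<tau>\<close> to \<open>heat_fun t R\<close> with convergence of \<open>R\<^sub>\<tau>\<close> to \<open>R\<close>.

  If \<open>R\<^sub>\<tau> \<rightarrow> R\<close> in norm, then \<open>f R\<^sub>\<tau> \<rightarrow> f R\<close> for every continuous \<open>f\<close>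
  (\<open>fun_op_continuous\<close>), and uniformly over the functions \<open>heat_fun t\<close> with \<open>t\<close> in a compact
  interval away from 0 (\<open>fun_op_heat_fun_uniform\<close>); here \<open>\<tau> = t / n\<close> tends to 0 uniformly in \<open>t\<close>.
  Conversely, a small \<open>\<tau>\<close> is \<open>t / n\<close> for \<open>n = \<lceil>1 / \<tau>\<rceil>\<close> and a \<open>t\<close> close to 1. Uniform convergence
  on \<open>[1, 2]\<close> and the Lipschitz dependence of the exponentials on \<open>t\<close> give
  \<open>heat_fun 1 R\<^sub>\<tau> \<rightarrow> heat_fun 1 R\<close>. The inverse of \<open>heat_fun 1\<close> is the continuous function
  \<open>u \<mapsto> 1 / (1 - ln u)\<close>, so applying it yields \<open>R\<^sub>\<tau> \<rightarrow> R\<close> (\<open>tendsto_of_heat_tendsto\<close>).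

  The functional calculus is built from Bernstein polynomials: on operators between 0 and 1 the
  basis polynomials are positive, and a second-moment identity gives convergence,
  multiplicativity and the norm bound at once. That \<open>heat_fun t R\<close> is the exponential, defined
  as the value of the only strongly continuous semigroup with generator \<open>- H\<close>, is
  \<open>exp_op_eq_heat\<close>; existence is a computation in the functional calculus, and uniqueness
  is a telescoping argument (\<open>semigroup_unique\<close>).
\<close>

section \<open>Polynomials in an operator\<close>

lemmas compose_simps =
  bounded_bilinear.add_left[OF bounded_bilinear_blinfun_compose]
  bounded_bilinear.add_right[OF bounded_bilinear_blinfun_compose]
  bounded_bilinear.diff_left[OF bounded_bilinear_blinfun_compose]
  bounded_bilinear.diff_right[OF bounded_bilinear_blinfun_compose]
  bounded_bilinear.minus_left[OF bounded_bilinear_blinfun_compose]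
  bounded_bilinear.minus_right[OF bounded_bilinear_blinfun_compose]
  bounded_bilinear.scaleR_left[OF bounded_bilinear_blinfun_compose]
  bounded_bilinear.scaleR_right[OF bounded_bilinear_blinfun_compose]
  bounded_bilinear.zero_left[OF bounded_bilinear_blinfun_compose]
  bounded_bilinear.zero_right[OF bounded_bilinear_blinfun_compose]

lemma compose_id [simp]: "T o\<^sub>L id_blinfun = T" "id_blinfun o\<^sub>L T = T"
  by (auto intro: blinfun_eqI)

lemma compose_assoc: "(A o\<^sub>L B) o\<^sub>L C = A o\<^sub>L (B o\<^sub>L C)"
  by (auto intro: blinfun_eqI)

lemma norm_id_blinfun_le: "norm (id_blinfun :: 'a::real_normed_vector \<Rightarrow>\<^sub>L 'a) \<le> 1"
  by (rule norm_blinfun_bound) auto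

definition poly_op :: "real poly \<Rightarrow> ('a::real_normed_vector \<Rightarrow>\<^sub>L 'a) \<Rightarrow> ('a \<Rightarrow>\<^sub>L 'a)" where
  "poly_op p A = fold_coeffs (\<lambda>c T. c *\<^sub>R id_blinfun + (A o\<^sub>L T)) p 0"

lemma poly_op_0 [simp]: "poly_op 0 A = 0"
  by (simp add: poly_op_def)

lemma poly_op_pCons [simp]: "poly_op (pCons c p) A = c *\<^sub>R id_blinfun + (A o\<^sub>L poly_op p A)"
  by (cases "p = 0 \<and> c = 0") (auto simp: poly_op_def compose_simps)

lemma poly_op_1 [simp]: "poly_op 1 A = id_blinfun"
  by (simp add: one_pCons compose_simps)

lemma poly_op_add: "poly_op (p + q) A = poly_op p A + poly_op q A"
  by (induction p q rule: poly_induct2) (auto simp: compose_simps algebra_simps)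

lemma poly_op_smult: "poly_op (smult c p) A = c *\<^sub>R poly_op p A"
  by (induction p) (auto simp: compose_simps algebra_simps)

lemma poly_op_diff: "poly_op (p - q) A = poly_op p A - poly_op q A"
proof -
  have "p - q = p + smult (-1) q" by simp
  then show ?thesis by (simp only: poly_op_add poly_op_smult) simp
qed

lemma poly_op_mult: "poly_op (p * q) A = poly_op p A o\<^sub>L poly_op q A"
  by (induction p) (auto simp: compose_simps poly_op_add poly_op_smult compose_assoc)

lemma poly_op_sum: "poly_op (\<Sum>i\<in>I. f i) A = (\<Sum>i\<in>I. poly_op (f i) A)"
  by (induction I rule: infinite_finite_induct) (auto simp: poly_op_add)

lemma poly_op_commute:
  assumes "T o\<^sub>L A = A o\<^sub>L T"
  shows "T o\<^sub>L poly_op p A = poly_op p A o\<^sub>L T"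
proof (induction p)
  case (pCons c p)
  have "T o\<^sub>L (A o\<^sub>L poly_op p A) = (A o\<^sub>L poly_op p A) o\<^sub>L T"
    using pCons(2) assms by (metis compose_assoc)
  then show ?case by (simp add: compose_simps)
qed (simp add: compose_simps)

lemma tendsto_poly_op:
  assumes "(B \<longlongrightarrow> A) G"
  shows "((\<lambda>\<tau>. poly_op p (B \<tau>)) \<longlongrightarrow> poly_op p A) G"
  by (induction p)
    (auto intro!: tendsto_add bounded_bilinear.tendsto[OF bounded_bilinear_blinfun_compose] assms)

section \<open>Positive operators\<close>

text \<open>
  Symmetry and positivity refer to the real inner product alone. The functional calculus below
  therefore lives in real Hilbert spaces; complex linearity of its values comes from commutation
  with the multiplications by complex scalars.
\<close>

definition pos_op :: "('a::real_inner \<Rightarrow>\<^sub>L 'a) \<Rightarrow> bool" where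
  "pos_op T \<longleftrightarrow> (\<forall>x y. inner (T x) y = inner x (T y)) \<and> (\<forall>x. 0 \<le> inner x (T x))"

definition unit_op :: "('a::real_inner \<Rightarrow>\<^sub>L 'a) \<Rightarrow> bool" where
  "unit_op A \<longleftrightarrow> pos_op A \<and> pos_op (id_blinfun - A)"

lemma pos_op_add: "pos_op S \<Longrightarrow> pos_op T \<Longrightarrow> pos_op (S + T)"
  by (auto simp: pos_op_def blinfun.bilinear_simps inner_simps)

lemma pos_op_scaleR: "0 \<le> c \<Longrightarrow> pos_op T \<Longrightarrow> pos_op (c *\<^sub>R T)"
  by (auto simp: pos_op_def blinfun.bilinear_simps inner_simps)

lemma pos_op_id: "pos_op id_blinfun"
  by (auto simp: pos_op_def)

lemma pos_op_0: "pos_op 0"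
  by (auto simp: pos_op_def)

lemma pos_op_sum: "(\<And>i. i \<in> I \<Longrightarrow> pos_op (f i)) \<Longrightarrow> pos_op (\<Sum>i\<in>I. f i)"
  by (induction I rule: infinite_finite_induct) (auto simp: pos_op_add pos_op_0)

lemma symmetric_poly_op:
  assumes "unit_op A"
  shows "inner (poly_op p A x) y = inner x (poly_op p A y)"
proof -
  have "inner (A x) y = inner x (A y)" for x y
    using assms by (simp add: unit_op_def pos_op_def)
  moreover have "A o\<^sub>L poly_op p A = poly_op p A o\<^sub>L A" for p
    by (rule poly_op_commute) simp
  then have "A (poly_op p A y) = poly_op p A (A y)" for p y
    by (metis blinfun_apply_blinfun_compose)
  ultimately show ?thesis
    by (induction p arbitrary: x y) (auto simp: blinfun.bilinear_simps inner_simps)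
qed

lemma pos_op_poly_sandwich:
  assumes "unit_op A" "pos_op (poly_op p A)"
  shows "pos_op (poly_op (q\<^sup>2 * p) A)"
proof -
  have "poly_op (q\<^sup>2 * p) A x = poly_op q A (poly_op p A (poly_op q A x))" for x
  proof -
    have "q\<^sup>2 * p = q * (p * q)" by (simp add: power2_eq_square)
    then show ?thesis by (simp only: poly_op_mult blinfun_apply_blinfun_compose)
  qed
  then show ?thesis
    using assms symmetric_poly_op[OF assms(1)] unfolding pos_op_def by metis
qed

abbreviation (input) X_poly :: "real poly" where "X_poly \<equiv> [:0, 1:]"
abbreviation (input) coX_poly :: "real poly" where "coX_poly \<equiv> [:1, -1:]"

text \<open>
  Write \<open>X\<close> for the operator and \<open>Y = 1 - X\<close>. Removing even powers as a square \<open>q\<^sup>2\<close>, which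
  acts as \<open>P \<mapsto> q P q\<close>, leaves exponents at most 1. The mixed case is settled by the
  identity \<open>X Y = X\<^sup>2 Y + Y\<^sup>2 X\<close>, whose summands are again squares times \<open>X\<close> or \<open>Y\<close>.
\<close>

lemma pos_op_monomial:
  assumes A: "unit_op A"
  shows "pos_op (poly_op (X_poly ^ k * coX_poly ^ m) A)"
proof -
  let ?P = "\<lambda>p. pos_op (poly_op p A)"
  have sq: "?P (q\<^sup>2 * p)" if "?P p" for p q
    using pos_op_poly_sandwich A that by blast
  have X: "?P X_poly" using A by (simp add: unit_op_def)
  have Y: "?P coX_poly" using A by (simp add: unit_op_def compose_simps)
  have "?P (X_poly\<^sup>2 * coX_poly + coX_poly\<^sup>2 * X_poly)"
    using sq[OF X] sq[OF Y] by (auto simp only: poly_op_add intro!: pos_op_add)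
  moreover have "X_poly\<^sup>2 * coX_poly + coX_poly\<^sup>2 * X_poly = X_poly * coX_poly"
    by (simp add: power2_eq_square)
  ultimately have XY: "?P (X_poly * coX_poly)" by simp
  have base: "?P (X_poly ^ (k mod 2) * coX_poly ^ (m mod 2))"
  proof -
    consider "k mod 2 = 0" "m mod 2 = 0" | "k mod 2 = 0" "m mod 2 = 1"
      | "k mod 2 = 1" "m mod 2 = 0" | "k mod 2 = 1" "m mod 2 = 1" by linarith
    then show ?thesis using X Y XY pos_op_id by cases (simp_all only: power_0 power_one_right
        mult_1 mult_1_right poly_op_1)
  qed
  have "X_poly ^ k * coX_poly ^ m
      = (X_poly ^ (k div 2) * coX_poly ^ (m div 2))\<^sup>2 * (X_poly ^ (k mod 2) * coX_poly ^ (m mod 2))"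
    (is "?l = ?r")
  proof -
    have "?r = X_poly ^ (2 * (k div 2) + k mod 2) * coX_poly ^ (2 * (m div 2) + m mod 2)"
      by (simp only: power_add power_mult power_mult_distrib power2_eq_square mult_ac)
    then show ?thesis by (simp only: mult_div_mod_eq)
  qed
  then show ?thesis using sq[OF base] by metis
qed

text \<open>
  For a positive form, \<open>2 \<bar>\<langle>y, P x\<rangle>\<bar> \<le> \<langle>x, P x\<rangle> + \<langle>y, P y\<rangle>\<close>, as the form is non-negative at
  \<open>x + y\<close> and \<open>x - y\<close>. Summing with weights bounds the bilinear form of the left-hand operator by
  the quadratic form of the dominating one.
  This is how pointwise bounds on coefficients become bounds in operator norm.
\<close>

lemma dominated_sum_norm_le:
  fixes P :: "'i \<Rightarrow> ('a::real_inner \<Rightarrow>\<^sub>L 'a)"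
  assumes P: "\<And>i. i \<in> I \<Longrightarrow> pos_op (P i)"
    and cd: "\<And>i. i \<in> I \<Longrightarrow> \<bar>c i\<bar> \<le> d i"
  shows "norm (\<Sum>i\<in>I. c i *\<^sub>R P i) \<le> norm (\<Sum>i\<in>I. d i *\<^sub>R P i)"
proof -
  define T where "T = (\<Sum>i\<in>I. c i *\<^sub>R P i)"
  define D where "D = (\<Sum>i\<in>I. d i *\<^sub>R P i)"
  have one: "\<bar>c i * inner y (P i x)\<bar> \<le> d i * ((inner x (P i x) + inner y (P i y)) / 2)"
    if "i \<in> I" for i x y
  proof -
    have s: "inner (P i x) y = inner x (P i y)" and p: "0 \<le> inner z (P i z)" for x y z
      using P[OF that] by (auto simp: pos_op_def)
    have "inner x (P i y) = inner y (P i x)" by (metis s inner_commute)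
    then have "\<bar>inner y (P i x)\<bar> \<le> (inner x (P i x) + inner y (P i y)) / 2"
      using p[of "x + y"] p[of "x - y"] by (simp add: blinfun.bilinear_simps inner_simps)
    then show ?thesis unfolding abs_mult using cd[OF that] by (intro mult_mono) auto
  qed
  have form: "inner y (T x) \<le> norm D * (((norm x)\<^sup>2 + (norm y)\<^sup>2) / 2)" for x y
  proof -
    have q: "inner z (D z) \<le> norm D * (norm z)\<^sup>2" for z
    proof -
      have "inner z (D z) \<le> norm z * norm (D z)" by (rule norm_cauchy_schwarz)
      also have "\<dots> \<le> norm z * (norm D * norm z)" by (intro mult_left_mono norm_blinfun) auto
      finally show ?thesis by (simp add: power2_eq_square mult_ac)
    qed
    have "inner y (T x) = (\<Sum>i\<in>I. c i * inner y (P i x))"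
      by (simp add: T_def blinfun.sum_left inner_sum_right blinfun.bilinear_simps)
    also have "\<dots> \<le> (\<Sum>i\<in>I. d i * ((inner x (P i x) + inner y (P i y)) / 2))"
      by (intro sum_mono) (use one in \<open>meson abs_le_D1\<close>)
    also have "\<dots> = (inner x (D x) + inner y (D y)) / 2"
      by (simp add: D_def blinfun.sum_left inner_sum_right blinfun.bilinear_simps
          sum.distrib[symmetric] sum_divide_distrib algebra_simps add_divide_distrib)
    also have "\<dots> \<le> norm D * (((norm x)\<^sup>2 + (norm y)\<^sup>2) / 2)"
      using q[of x] q[of y] by (simp add: algebra_simps)
    finally show ?thesis .
  qed
  have "norm (T x) \<le> norm D * norm x" for x
  proof (cases "T x = 0 \<or> x = 0")
    case False
    \<comment> \<open>rescaling the second vector to the length of the first balances the two squares\<close>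
    define y where "y = (norm x / norm (T x)) *\<^sub>R T x"
    have "norm y = norm x" using False by (simp add: y_def)
    moreover have "inner y (T x) = norm x * norm (T x)"
      using False by (simp add: y_def dot_square_norm power2_eq_square)
    ultimately have "norm x * norm (T x) \<le> norm D * (norm x * norm x)"
      using form[of y x] by (simp add: power2_eq_square)
    then show ?thesis using False by (simp add: mult.left_commute)
  qed (auto simp: blinfun.bilinear_simps)
  then show ?thesis
    unfolding T_def[symmetric] D_def[symmetric] by (intro norm_blinfun_bound) auto
qed

lemma unit_op_norm_le:
  fixes A :: "'a::real_inner \<Rightarrow>\<^sub>L 'a"
  assumes "unit_op A" shows "norm A \<le> 1"
proof -
  have "norm (\<Sum>i\<in>{True,False}. (if i then 1 else 0) *\<^sub>R (if i then A else id_blinfun - A))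
     \<le> norm (\<Sum>i\<in>{True,False}. 1 *\<^sub>R (if i then A else id_blinfun - A))"
    using assms by (intro dominated_sum_norm_le) (auto simp: unit_op_def)
  then show ?thesis using norm_id_blinfun_le[where 'a='a] by simp
qed

lemma unit_opI:
  fixes A :: "'a::real_inner \<Rightarrow>\<^sub>L 'a"
  assumes "\<And>x y. inner (A x) y = inner x (A y)" "\<And>x. 0 \<le> inner x (A x)"
    "\<And>x. norm (A x) \<le> norm x"
  shows "unit_op A"
proof -
  have "inner x (A x) \<le> inner x x" for x
  proof -
    have "inner x (A x) \<le> norm x * norm (A x)" by (rule norm_cauchy_schwarz)
    also have "\<dots> \<le> norm x * norm x" using assms(3) by (intro mult_left_mono) auto
    finally show ?thesis by (simp add: dot_square_norm power2_eq_square)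
  qed
  then show ?thesis
    using assms by (auto simp: unit_op_def pos_op_def blinfun.bilinear_simps inner_simps)
qed

lemma closed_pos_op: "closed {T :: 'a::real_inner \<Rightarrow>\<^sub>L 'a. pos_op T}"
  unfolding pos_op_def Collect_conj_eq
  by (intro closed_Int closed_Collect_all closed_Collect_eq closed_Collect_le continuous_intros)

section \<open>Bernstein polynomials of an operator\<close>

text \<open>
  The Bernstein basis as formal polynomials: identities between them are checked at real
  arguments and then hold for every operator substituted for \<open>X\<close>.
\<close>

definition bern :: "nat \<Rightarrow> nat \<Rightarrow> real poly" where
  "bern n k = smult (real (n choose k)) (X_poly ^ k * coX_poly ^ (n - k))"

definition bern_poly :: "nat \<Rightarrow> (real \<Rightarrow> real) \<Rightarrow> real poly" where
  "bern_poly n f = (\<Sum>k\<le>n. smult (f (k / n)) (bern n k))"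

lemma poly_bern [simp]: "poly (bern n k) x = Bernstein n k x"
  by (simp add: bern_def Bernstein_def)

lemma poly_eqI_real: "(\<And>x::real. poly p x = poly q x) \<Longrightarrow> p = q"
  by (simp add: poly_eq_poly_eq_iff[symmetric] ext)

lemma sum_bern: "(\<Sum>k\<le>n. bern n k) = 1"
  by (rule poly_eqI_real) (simp add: poly_sum)

lemma Bernstein_variance:
  assumes n: "n > 0"
  shows "(\<Sum>k\<le>n. (k / n - x)\<^sup>2 * Bernstein n k x) = x * (1 - x) / n"
proof -
  let ?b = "\<lambda>k. Bernstein n k x"
  have "(k / n - x)\<^sup>2 * ?b k = (1 / real n)\<^sup>2 * (real k * (real k - 1) * ?b k)
      + ((1 / real n)\<^sup>2 - 2 * x / n) * (real k * ?b k) + x\<^sup>2 * ?b k" for k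
    using n by (simp add: field_simps power2_eq_square)
  then have "(\<Sum>k\<le>n. (k / n - x)\<^sup>2 * ?b k) = (1 / real n)\<^sup>2 * (real n * (real n - 1) * x\<^sup>2)
      + ((1 / real n)\<^sup>2 - 2 * x / n) * (real n * x) + x\<^sup>2 * 1"
    by (simp only: sum.distrib sum_distrib_left[symmetric] sum_kk_Bernstein sum_k_Bernstein sum_Bernstein)
  also have "\<dots> = x * (1 - x) / n"
    using n by (simp add: field_simps power2_eq_square)
  finally show ?thesis .
qed

lemma Bernstein_mean:
  assumes "n > 0" shows "(\<Sum>k\<le>n. k / n * Bernstein n k x) = x"
proof -
  have "(\<Sum>k\<le>n. k / n * Bernstein n k x) = (\<Sum>k\<le>n. k * Bernstein n k x) / n"
    by (simp only: sum_divide_distrib times_divide_eq_left)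
  also have "\<dots> = x" using assms by simp
  finally show ?thesis .
qed

text \<open>
  For independent binomial variables \<open>K\<close>, \<open>L\<close> with \<open>n\<close> and \<open>m\<close> trials and success probability \<open>x\<close>,
  this is the second moment of \<open>K / n - L / m\<close>: both have mean \<open>x\<close>, so the variances add.
\<close>

lemma Bernstein_double_variance:
  assumes "n > 0" "m > 0"
  shows "(\<Sum>k\<le>n. \<Sum>l\<le>m. (k / n - l / m)\<^sup>2 * (Bernstein n k x * Bernstein m l x))
       = (1 / n + 1 / m) * (x * (1 - x))"
proof -
  let ?b = "Bernstein n" and ?c = "Bernstein m"
  have mean0: "(\<Sum>k\<le>n. (k / n - x) * Bernstein n k x) = 0" if "n > 0" for n
    using Bernstein_mean[OF that, of x]
    by (simp add: left_diff_distrib sum_subtractf sum_distrib_left[symmetric])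
  have split: "(k / n - l / m)\<^sup>2 * (?b k x * ?c l x)
      = (k / n - x)\<^sup>2 * ?b k x * ?c l x + ?b k x * ((l / m - x)\<^sup>2 * ?c l x)
        - 2 * ((k / n - x) * ?b k x) * ((l / m - x) * ?c l x)" for k l :: nat
  proof -
    have *: "(a - b)\<^sup>2 * (u * v) = (a - x)\<^sup>2 * u * v + u * ((b - x)\<^sup>2 * v)
        - 2 * ((a - x) * u) * ((b - x) * v)" for a b u v :: real
      by (simp add: power2_eq_square algebra_simps)
    show ?thesis by (rule *)
  qed
  have "(\<Sum>k\<le>n. \<Sum>l\<le>m. (k / n - l / m)\<^sup>2 * (?b k x * ?c l x))
      = (\<Sum>k\<le>n. (k / n - x)\<^sup>2 * ?b k x) * (\<Sum>l\<le>m. ?c l x)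
        + (\<Sum>k\<le>n. ?b k x) * (\<Sum>l\<le>m. (l / m - x)\<^sup>2 * ?c l x)
        - 2 * ((\<Sum>k\<le>n. (k / n - x) * ?b k x) * (\<Sum>l\<le>m. (l / m - x) * ?c l x))"
    unfolding split sum_subtractf sum.distrib sum_product
    by (simp add: sum_distrib_left mult.assoc)
  also have "\<dots> = (1 / n + 1 / m) * (x * (1 - x))"
    unfolding Bernstein_variance[OF assms(1)] Bernstein_variance[OF assms(2)]
      mean0[OF assms(1)] mean0[OF assms(2)] sum_Bernstein
    by (simp add: algebra_simps diff_divide_distrib)
  finally show ?thesis .
qed

lemma pos_op_bern_mult:
  assumes "unit_op A"
  shows "pos_op (poly_op (bern n k * bern m l) A)"
proof -
  have "bern n k * bern m l = smult (real (n choose k) * real (m choose l))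
      (X_poly ^ (k + l) * coX_poly ^ ((n - k) + (m - l)))"
    unfolding bern_def by (simp only: power_add mult_smult_left mult_smult_right smult_smult mult_ac)
  then show ?thesis
    using pos_op_monomial[OF assms] by (simp only: poly_op_smult) (auto intro: pos_op_scaleR)
qed

lemma pos_op_bern: "unit_op A \<Longrightarrow> pos_op (poly_op (bern n k) A)"
  using pos_op_bern_mult[of A n k 0 0] by (simp add: bern_def)

text \<open>
  The single estimate behind convergence and multiplicativity of the functional calculus. The
  products \<open>b\<^sub>n\<^sub>,\<^sub>k b\<^sub>m\<^sub>,\<^sub>l\<close> of Bernstein polynomials are positive on operators between 0 and 1, so a kernel
  \<open>G\<close> with \<open>\<bar>G s t\<bar> \<le> \<epsilon> + C (s - t)\<^sup>2\<close> gives an operator dominated by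
  \<open>\<epsilon> + C (1/n + 1/m) A (1 - A)\<close>, by the variance identity.
\<close>

lemma double_bern_norm_le:
  fixes A :: "'a::real_inner \<Rightarrow>\<^sub>L 'a"
  assumes A: "unit_op A" and nm: "n > 0" "m > 0" and "0 \<le> \<epsilon>" "0 \<le> C"
    and G: "\<And>s t. s \<in> {0..1} \<Longrightarrow> t \<in> {0..1} \<Longrightarrow> \<bar>G s t\<bar> \<le> \<epsilon> + C * (s - t)\<^sup>2"
  shows "norm (poly_op (\<Sum>k\<le>n. \<Sum>l\<le>m. smult (G (k / n) (l / m)) (bern n k * bern m l)) A)
     \<le> \<epsilon> + C * (1 / n + 1 / m)"
proof -
  let ?b = "\<lambda>i. poly_op (bern n (fst i) * bern m (snd i)) A"
  define d where "d i = \<epsilon> + C * (real (fst i) / n - real (snd i) / m)\<^sup>2" for i :: "nat \<times> nat"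
  have "norm (poly_op (\<Sum>k\<le>n. \<Sum>l\<le>m. smult (G (k / n) (l / m)) (bern n k * bern m l)) A)
     = norm (\<Sum>i\<in>{..n} \<times> {..m}. G (fst i / n) (snd i / m) *\<^sub>R ?b i)"
    by (simp add: poly_op_sum poly_op_smult sum.cartesian_product case_prod_unfold)
  also have "\<dots> \<le> norm (\<Sum>i\<in>{..n} \<times> {..m}. d i *\<^sub>R ?b i)"
    using nm by (intro dominated_sum_norm_le pos_op_bern_mult A) (auto simp: d_def intro!: G)
  also have "(\<Sum>i\<in>{..n} \<times> {..m}. d i *\<^sub>R ?b i)
     = poly_op (\<Sum>k\<le>n. \<Sum>l\<le>m. smult (d (k, l)) (bern n k * bern m l)) A"
    by (simp add: poly_op_sum poly_op_smult sum.cartesian_product case_prod_unfold)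
  also have "(\<Sum>k\<le>n. \<Sum>l\<le>m. smult (d (k, l)) (bern n k * bern m l))
     = [:\<epsilon>:] + smult (C * (1 / n + 1 / m)) (X_poly * coX_poly)"
  proof (rule poly_eqI_real)
    fix x :: real
    have "poly (\<Sum>k\<le>n. \<Sum>l\<le>m. smult (d (k, l)) (bern n k * bern m l)) x
      = (\<Sum>k\<le>n. \<Sum>l\<le>m. \<epsilon> * (Bernstein n k x * Bernstein m l x)
          + C * ((k / n - l / m)\<^sup>2 * (Bernstein n k x * Bernstein m l x)))"
      by (simp add: poly_sum d_def algebra_simps)
    also have "\<dots> = \<epsilon> * ((\<Sum>k\<le>n. Bernstein n k x) * (\<Sum>l\<le>m. Bernstein m l x))
          + C * (\<Sum>k\<le>n. \<Sum>l\<le>m. (k / n - l / m)\<^sup>2 * (Bernstein n k x * Bernstein m l x))"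
      by (simp only: sum.distrib sum_product) (simp add: sum_distrib_left)
    also have "\<dots> = poly ([:\<epsilon>:] + smult (C * (1 / n + 1 / m)) (X_poly * coX_poly)) x"
      unfolding Bernstein_double_variance[OF nm] sum_Bernstein by (simp add: algebra_simps)
    finally show "poly (\<Sum>k\<le>n. \<Sum>l\<le>m. smult (d (k, l)) (bern n k * bern m l)) x = \<dots>" .
  qed
  also have "norm (poly_op ([:\<epsilon>:] + smult (C * (1 / n + 1 / m)) (X_poly * coX_poly)) A)
     \<le> norm (poly_op [:\<epsilon>:] A) + norm (poly_op (smult (C * (1 / n + 1 / m)) (X_poly * coX_poly)) A)"
    unfolding poly_op_add by (rule norm_triangle_ineq)
  also have "\<dots> \<le> \<epsilon> * 1 + C * (1 / n + 1 / m) * 1"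
  proof (rule add_mono)
    show "norm (poly_op [:\<epsilon>:] A) \<le> \<epsilon> * 1"
      using \<open>0 \<le> \<epsilon>\<close> norm_id_blinfun_le[where 'a='a]
      by (simp add: compose_simps mult_left_le)
    have "unit_op (id_blinfun - A)" using A by (simp add: unit_op_def)
    have "norm (A o\<^sub>L (id_blinfun - A)) \<le> norm A * norm (id_blinfun - A)"
      by (rule norm_blinfun_compose)
    also have "\<dots> \<le> 1"
      using unit_op_norm_le[OF A] unit_op_norm_le[OF \<open>unit_op (id_blinfun - A)\<close>]
      by (simp add: mult_le_one)
    finally have "norm (poly_op (X_poly * coX_poly) A) \<le> 1"
      unfolding poly_op_mult by (simp add: compose_simps)
    then have "\<bar>C * (1 / n + 1 / m)\<bar> * norm (poly_op (X_poly * coX_poly) A)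
        \<le> \<bar>C * (1 / n + 1 / m)\<bar> * 1"
      by (intro mult_left_mono) auto
    then show "norm (poly_op (smult (C * (1 / n + 1 / m)) (X_poly * coX_poly)) A)
        \<le> C * (1 / n + 1 / m) * 1"
      unfolding poly_op_smult norm_scaleR using \<open>0 \<le> C\<close> by simp
  qed
  finally show ?thesis by simp
qed

section \<open>The continuous functional calculus\<close>

text \<open>
  \<open>f(A)\<close> as the limit of the Bernstein polynomials of \<open>f\<close> at \<open>A\<close>. The norm
  bound by the supremum of \<open>\<bar>f\<bar>\<close> is immediate from the positivity of the basis.
\<close>

definition fun_op :: "('a::{real_inner,banach} \<Rightarrow>\<^sub>L 'a) \<Rightarrow> (real \<Rightarrow> real) \<Rightarrow> ('a \<Rightarrow>\<^sub>L 'a)" where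
  "fun_op A f = lim (\<lambda>n. poly_op (bern_poly n f) A)"

text \<open>
  Uniform continuity handles nearby points; for distant ones \<open>(s - t)\<^sup>2\<close> is bounded below and
  absorbs twice the supremum of \<open>\<bar>f\<bar>\<close>.
\<close>

lemma quadratic_modulus:
  fixes f :: "real \<Rightarrow> real"
  assumes f: "continuous_on {0..1} f" and \<epsilon>: "0 < \<epsilon>"
  obtains C where "0 \<le> C"
    "\<And>s t. s \<in> {0..1} \<Longrightarrow> t \<in> {0..1} \<Longrightarrow> \<bar>f s - f t\<bar> \<le> \<epsilon> + C * (s - t)\<^sup>2"
proof -
  have "bounded (f ` {0..1})"
    using compact_continuous_image compact_imp_bounded f by blast
  then obtain M where M: "\<And>x. x \<in> {0..1} \<Longrightarrow> \<bar>f x\<bar> \<le> M"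
    by (force simp: bounded_iff)
  have "0 \<le> M" using M[of 0] by auto
  have "uniformly_continuous_on {0..1} f"
    using compact_uniformly_continuous f by blast
  then obtain d where d: "d > 0"
    "\<And>x x'. x \<in> {0..1} \<Longrightarrow> x' \<in> {0..1} \<Longrightarrow> \<bar>x' - x\<bar> < d \<Longrightarrow> \<bar>f x' - f x\<bar> < \<epsilon>"
    using \<epsilon> unfolding uniformly_continuous_on_def dist_real_def by metis
  have "\<bar>f s - f t\<bar> \<le> \<epsilon> + 2 * M / d\<^sup>2 * (s - t)\<^sup>2" if st: "s \<in> {0..1}" "t \<in> {0..1}" for s t
  proof (cases "\<bar>s - t\<bar> < d")
    case True
    then have "\<bar>f s - f t\<bar> \<le> \<epsilon>" using d(2) st by force
    then show ?thesis using \<open>0 \<le> M\<close> by (smt (verit) divide_nonneg_nonneg mult_nonneg_nonneg zero_le_power2)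
  next
    case False
    then have "d\<^sup>2 \<le> (s - t)\<^sup>2" using d(1) by (metis not_less power2_abs power_mono less_imp_le)
    then have "1 \<le> (s - t)\<^sup>2 / d\<^sup>2" using d(1) by simp
    then have "2 * M * 1 \<le> 2 * M * ((s - t)\<^sup>2 / d\<^sup>2)" using \<open>0 \<le> M\<close> by (intro mult_left_mono) auto
    moreover have "\<bar>f s - f t\<bar> \<le> 2 * M" using M[OF st(1)] M[OF st(2)] by linarith
    ultimately show ?thesis using \<epsilon> by simp
  qed
  then show thesis using \<open>0 \<le> M\<close> that[of "2 * M / d\<^sup>2"] by simp
qed

lemma poly_bern_poly: "poly (bern_poly n f) x = (\<Sum>k\<le>n. f (k / n) * Bernstein n k x)"
  by (simp add: bern_poly_def poly_sum)

text \<open>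
  Both sides become double sums after multiplication by \<open>1 = \<Sum>\<^sub>l b\<^sub>m\<^sub>,\<^sub>l\<close> and \<open>1 = \<Sum>\<^sub>k b\<^sub>n\<^sub>,\<^sub>k\<close>.
\<close>

lemma bern_poly_diff:
  "bern_poly n f - bern_poly m f
   = (\<Sum>k\<le>n. \<Sum>l\<le>m. smult (f (k / n) - f (l / m)) (bern n k * bern m l))"
proof (rule poly_eqI_real)
  fix x
  let ?b = "\<lambda>k. Bernstein n k x" and ?c = "\<lambda>l. Bernstein m l x"
  have "poly (\<Sum>k\<le>n. \<Sum>l\<le>m. smult (f (k / n) - f (l / m)) (bern n k * bern m l)) x
     = (\<Sum>k\<le>n. \<Sum>l\<le>m. (f (k / n) * ?b k) * ?c l - ?b k * (f (l / m) * ?c l))"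
    by (simp add: poly_sum algebra_simps)
  also have "\<dots> = (\<Sum>k\<le>n. f (k / n) * ?b k) * (\<Sum>l\<le>m. ?c l) - (\<Sum>k\<le>n. ?b k) * (\<Sum>l\<le>m. f (l / m) * ?c l)"
    by (simp only: sum_subtractf sum_product)
  also have "\<dots> = poly (bern_poly n f - bern_poly m f) x"
    by (simp add: poly_bern_poly)
  finally show "poly (bern_poly n f - bern_poly m f) x
     = poly (\<Sum>k\<le>n. \<Sum>l\<le>m. smult (f (k / n) - f (l / m)) (bern n k * bern m l)) x" by simp
qed

text \<open>
  The covariance of \<open>f(K/n)\<close> and \<open>g(K/n)\<close> for a binomial variable \<open>K\<close>, symmetrised by an
  independent copy. The two differences make the kernel vanish on the diagonal, where
  \<open>double_bern_norm_le\<close> needs it to be small.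
\<close>

lemma bern_poly_mult_defect:
  "bern_poly n (\<lambda>x. f x * g x) - bern_poly n f * bern_poly n g
   = (\<Sum>k\<le>n. \<Sum>l\<le>n. smult ((f (k / n) - f (l / n)) * (g (k / n) - g (l / n)) / 2) (bern n k * bern n l))"
proof (rule poly_eqI_real)
  fix x
  let ?b = "\<lambda>k. Bernstein n k x"
  let ?F = "\<lambda>k::nat. f (k / n)" and ?G = "\<lambda>k::nat. g (k / n)"
  have "poly (\<Sum>k\<le>n. \<Sum>l\<le>n. smult ((?F k - ?F l) * (?G k - ?G l) / 2) (bern n k * bern n l)) x
     = (\<Sum>k\<le>n. \<Sum>l\<le>n. (?F k * ?G k * ?b k) * ?b l / 2 + ?b k * (?F l * ?G l * ?b l) / 2
          - (?F k * ?b k) * (?G l * ?b l) / 2 - (?G k * ?b k) * (?F l * ?b l) / 2)"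
    by (simp add: poly_sum algebra_simps diff_divide_distrib add_divide_distrib)
  also have "\<dots> = (\<Sum>k\<le>n. ?F k * ?G k * ?b k) * (\<Sum>l\<le>n. ?b l) / 2
       + (\<Sum>k\<le>n. ?b k) * (\<Sum>l\<le>n. ?F l * ?G l * ?b l) / 2
       - (\<Sum>k\<le>n. ?F k * ?b k) * (\<Sum>l\<le>n. ?G l * ?b l) / 2
       - (\<Sum>k\<le>n. ?G k * ?b k) * (\<Sum>l\<le>n. ?F l * ?b l) / 2"
    by (simp only: sum_subtractf sum.distrib sum_product sum_divide_distrib)
  also have "\<dots> = poly (bern_poly n (\<lambda>x. f x * g x) - bern_poly n f * bern_poly n g) x"
    by (simp add: poly_bern_poly)
  finally show "poly (bern_poly n (\<lambda>x. f x * g x) - bern_poly n f * bern_poly n g) x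
     = poly (\<Sum>k\<le>n. \<Sum>l\<le>n. smult ((?F k - ?F l) * (?G k - ?G l) / 2) (bern n k * bern n l)) x" by simp
qed

lemma tendsto_fun_op:
  fixes A :: "'a::{real_inner,banach} \<Rightarrow>\<^sub>L 'a"
  assumes A: "unit_op A" and f: "continuous_on {0..1} f"
  shows "(\<lambda>n. poly_op (bern_poly n f) A) \<longlonglongrightarrow> fun_op A f"
proof -
  have "Cauchy (\<lambda>n. poly_op (bern_poly n f) A)"
  proof (rule CauchyI)
    fix e :: real assume e: "0 < e"
    then have "0 < e / 2" by simp
    from quadratic_modulus[OF f this] obtain C where C: "0 \<le> C"
      "\<And>s t. s \<in> {0..1} \<Longrightarrow> t \<in> {0..1} \<Longrightarrow> \<bar>f s - f t\<bar> \<le> e / 2 + C * (s - t)\<^sup>2" by metis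
    obtain N :: nat where N: "N > 4 * C / e" using reals_Archimedean2 by blast
    have small: "C * (1 / real n) < e / 4" if "Suc N \<le> n" for n
    proof -
      have "4 * C / e < n" using N that by linarith
      then have "4 * C < e * n" using e by (simp add: field_simps)
      then show ?thesis using that by (simp add: field_simps)
    qed
    show "\<exists>M. \<forall>m\<ge>M. \<forall>n\<ge>M. norm (poly_op (bern_poly m f) A - poly_op (bern_poly n f) A) < e"
    proof (intro exI allI impI)
      fix m n assume mn: "Suc N \<le> m" "Suc N \<le> n"
      have "norm (poly_op (bern_poly m f) A - poly_op (bern_poly n f) A)
         \<le> e / 2 + C * (1 / m + 1 / n)"
        unfolding poly_op_diff[symmetric] bern_poly_diff
        using mn e C by (intro double_bern_norm_le A) auto
      also have "\<dots> < e" using small[OF mn(1)] small[OF mn(2)] unfolding distrib_left by linarith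
      finally show "norm (poly_op (bern_poly m f) A - poly_op (bern_poly n f) A) < e" .
    qed
  qed
  then show ?thesis unfolding fun_op_def convergent_LIMSEQ_iff[symmetric]
    by (rule Cauchy_convergent)
qed

lemma fun_op_eqI:
  assumes "unit_op A" "continuous_on {0..1} f"
    and "(\<lambda>n. poly_op (bern_poly n f) A) \<longlonglongrightarrow> T"
  shows "fun_op A f = T"
  using LIMSEQ_unique[OF tendsto_fun_op[OF assms(1,2)] assms(3)] .

lemma bern_poly_cong:
  assumes "\<And>x. x \<in> {0..1} \<Longrightarrow> f x = g x"
  shows "bern_poly n f = bern_poly n g"
  unfolding bern_poly_def by (intro sum.cong refl arg_cong2[of _ _ _ _ smult] assms)
    (auto simp: divide_le_eq_1)

lemma fun_op_cong: "(\<And>x. x \<in> {0..1} \<Longrightarrow> f x = g x) \<Longrightarrow> fun_op A f = fun_op A g"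
  unfolding fun_op_def using bern_poly_cong by metis

lemma fun_op_add:
  assumes "unit_op A" "continuous_on {0..1} f" "continuous_on {0..1} g"
  shows "fun_op A (\<lambda>x. f x + g x) = fun_op A f + fun_op A g"
proof (rule fun_op_eqI)
  have "bern_poly n (\<lambda>x. f x + g x) = bern_poly n f + bern_poly n g" for n
    by (simp add: bern_poly_def smult_add_left sum.distrib)
  then show "(\<lambda>n. poly_op (bern_poly n (\<lambda>x. f x + g x)) A) \<longlonglongrightarrow> fun_op A f + fun_op A g"
    by (simp add: poly_op_add assms tendsto_add tendsto_fun_op)
qed (use assms in \<open>auto intro!: continuous_intros\<close>)

lemma fun_op_scaleR:
  assumes "unit_op A" "continuous_on {0..1} f"
  shows "fun_op A (\<lambda>x. c * f x) = c *\<^sub>R fun_op A f"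
proof (rule fun_op_eqI)
  have "bern_poly n (\<lambda>x. c * f x) = smult c (bern_poly n f)" for n
    by (rule poly_eqI_real) (simp add: poly_bern_poly sum_distrib_left mult.assoc)
  then show "(\<lambda>n. poly_op (bern_poly n (\<lambda>x. c * f x)) A) \<longlonglongrightarrow> c *\<^sub>R fun_op A f"
    by (simp add: poly_op_smult assms tendsto_scaleR tendsto_fun_op)
qed (use assms in \<open>auto intro!: continuous_intros\<close>)

lemma fun_op_diff:
  assumes "unit_op A" "continuous_on {0..1} f" "continuous_on {0..1} g"
  shows "fun_op A (\<lambda>x. f x - g x) = fun_op A f - fun_op A g"
  using fun_op_add[of A f "\<lambda>x. -1 * g x"] fun_op_scaleR[of A g "-1"] assms
  by (simp add: continuous_on_minus)

lemma fun_op_const: "unit_op A \<Longrightarrow> fun_op A (\<lambda>_. c) = c *\<^sub>R id_blinfun"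
proof (rule fun_op_eqI)
  have "bern_poly n (\<lambda>_. c) = smult c 1" for n
    by (rule poly_eqI_real) (simp add: poly_bern_poly sum_distrib_left[symmetric])
  then show "(\<lambda>n. poly_op (bern_poly n (\<lambda>_. c)) A) \<longlonglongrightarrow> c *\<^sub>R id_blinfun"
    by (simp only: poly_op_smult poly_op_1) simp
qed auto

lemma fun_op_ident: "unit_op A \<Longrightarrow> fun_op A (\<lambda>x. x) = A"
proof (rule fun_op_eqI)
  have "bern_poly n (\<lambda>x. x) = X_poly" if "n > 0" for n
    by (rule poly_eqI_real) (simp add: poly_bern_poly Bernstein_mean[OF that, simplified])
  then have "\<forall>\<^sub>F n in sequentially. poly_op (bern_poly n (\<lambda>x. x)) A = A"
    by (intro eventually_mono[OF eventually_gt_at_top[of 0]]) (simp add: compose_simps)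
  then show "(\<lambda>n. poly_op (bern_poly n (\<lambda>x. x)) A) \<longlonglongrightarrow> A"
    by (rule tendsto_eventually)
qed auto

lemma fun_op_mult:
  fixes A :: "'a::{real_inner,banach} \<Rightarrow>\<^sub>L 'a"
  assumes A: "unit_op A" and f: "continuous_on {0..1} f" and g: "continuous_on {0..1} g"
  shows "fun_op A (\<lambda>x. f x * g x) = fun_op A f o\<^sub>L fun_op A g"
proof (rule LIMSEQ_unique)
  show "(\<lambda>n. poly_op (bern_poly n (\<lambda>x. f x * g x)) A) \<longlonglongrightarrow> fun_op A (\<lambda>x. f x * g x)"
    using A f g by (intro tendsto_fun_op continuous_intros)
  have "bounded (g ` {0..1})"
    using compact_continuous_image compact_imp_bounded g by blast
  then obtain M where M: "\<And>x. x \<in> {0..1} \<Longrightarrow> \<bar>g x\<bar> \<le> M" and "0 < M"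
    by (force simp: bounded_pos)
  have "(\<lambda>n. poly_op (bern_poly n (\<lambda>x. f x * g x)) A
      - (poly_op (bern_poly n f) A o\<^sub>L poly_op (bern_poly n g) A)) \<longlonglongrightarrow> 0"
  proof (rule LIMSEQ_I)
    fix e :: real assume e: "0 < e"
    then have "0 < e / (2 * M)" using \<open>0 < M\<close> by simp
    from quadratic_modulus[OF f this] obtain C where C: "0 \<le> C"
      "\<And>s t. s \<in> {0..1} \<Longrightarrow> t \<in> {0..1} \<Longrightarrow> \<bar>f s - f t\<bar> \<le> e / (2 * M) + C * (s - t)\<^sup>2" by metis
    obtain N :: nat where N: "N > 4 * (M * C) / e" using reals_Archimedean2 by blast
    show "\<exists>N. \<forall>n\<ge>N. norm (poly_op (bern_poly n (\<lambda>x. f x * g x)) A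
      - (poly_op (bern_poly n f) A o\<^sub>L poly_op (bern_poly n g) A) - 0) < e"
    proof (intro exI allI impI)
      fix n assume n: "Suc N \<le> n"
      have "norm (poly_op (bern_poly n (\<lambda>x. f x * g x)) A
          - (poly_op (bern_poly n f) A o\<^sub>L poly_op (bern_poly n g) A) - 0)
        \<le> e / 2 + M * C * (1 / n + 1 / n)"
        unfolding poly_op_diff[symmetric] poly_op_mult[symmetric] bern_poly_mult_defect diff_zero
      proof (intro double_bern_norm_le A)
        fix s t :: real assume st: "s \<in> {0..1}" "t \<in> {0..1}"
        have "\<bar>(f s - f t) * (g s - g t) / 2\<bar> = \<bar>f s - f t\<bar> * (\<bar>g s - g t\<bar> / 2)"
          by (simp add: abs_mult)
        also have "\<dots> \<le> (e / (2 * M) + C * (s - t)\<^sup>2) * M"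
        proof (rule mult_mono)
          have "\<bar>g s - g t\<bar> \<le> 2 * M" using M[OF st(1)] M[OF st(2)] by linarith
          then show "\<bar>g s - g t\<bar> / 2 \<le> M" by simp
          show "0 \<le> e / (2 * M) + C * (s - t)\<^sup>2" using C(1) e \<open>0 < M\<close> by simp
        qed (use C(2)[OF st] in auto)
        also have "\<dots> = e / 2 + M * C * (s - t)\<^sup>2" using \<open>0 < M\<close> by (simp add: field_simps)
        finally show "\<bar>(f s - f t) * (g s - g t) / 2\<bar> \<le> e / 2 + M * C * (s - t)\<^sup>2" .
      qed (use n e C \<open>0 < M\<close> in auto)
      also have "\<dots> < e"
      proof -
        have "4 * (M * C) / e < n" using N n by linarith
        then have "4 * (M * C) < e * n" using e by (simp add: field_simps)
        then have "M * C * (1 / n + 1 / n) < e / 2" using n by (simp add: field_simps)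
        then show ?thesis by simp
      qed
      finally show "norm (poly_op (bern_poly n (\<lambda>x. f x * g x)) A
          - (poly_op (bern_poly n f) A o\<^sub>L poly_op (bern_poly n g) A) - 0) < e" .
    qed
  qed
  moreover have "(\<lambda>n. poly_op (bern_poly n f) A o\<^sub>L poly_op (bern_poly n g) A)
      \<longlonglongrightarrow> (fun_op A f o\<^sub>L fun_op A g)"
    using A f g
    by (intro bounded_bilinear.tendsto[OF bounded_bilinear_blinfun_compose] tendsto_fun_op)
  ultimately show "(\<lambda>n. poly_op (bern_poly n (\<lambda>x. f x * g x)) A) \<longlonglongrightarrow> (fun_op A f o\<^sub>L fun_op A g)"
    by (rule Lim_transform[rotated])
qed

lemma fun_op_norm_le:
  fixes A :: "'a::{real_inner,banach} \<Rightarrow>\<^sub>L 'a"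
  assumes A: "unit_op A" and f: "continuous_on {0..1} f"
    and M: "\<And>x. x \<in> {0..1} \<Longrightarrow> \<bar>f x\<bar> \<le> M"
  shows "norm (fun_op A f) \<le> M"
proof (rule Lim_bounded)
  show "(\<lambda>n. norm (poly_op (bern_poly n f) A)) \<longlonglongrightarrow> norm (fun_op A f)"
    using A f by (intro tendsto_norm tendsto_fun_op)
  show "\<forall>n\<ge>0. norm (poly_op (bern_poly n f) A) \<le> M"
  proof (intro allI impI)
    fix n :: nat
    have "0 \<le> M" using M[of 0] by auto
    have "norm (poly_op (bern_poly n f) A) = norm (\<Sum>k\<le>n. f (k / n) *\<^sub>R poly_op (bern n k) A)"
      by (simp add: bern_poly_def poly_op_sum poly_op_smult)
    also have "\<dots> \<le> norm (\<Sum>k\<le>n. M *\<^sub>R poly_op (bern n k) A)"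
      by (intro dominated_sum_norm_le pos_op_bern A M) (auto simp: divide_le_eq_1)
    also have "(\<Sum>k\<le>n. M *\<^sub>R poly_op (bern n k) A) = M *\<^sub>R id_blinfun"
      by (simp add: scaleR_sum_right[symmetric] poly_op_sum[symmetric] sum_bern)
    also have "norm (M *\<^sub>R (id_blinfun :: 'a \<Rightarrow>\<^sub>L 'a)) \<le> M"
      using \<open>0 \<le> M\<close> norm_id_blinfun_le[where 'a='a] by (simp add: mult_left_le)
    finally show "norm (poly_op (bern_poly n f) A) \<le> M" .
  qed
qed

lemma fun_op_dist_le:
  assumes "unit_op A" "continuous_on {0..1} f" "continuous_on {0..1} g"
    and "\<And>x. x \<in> {0..1} \<Longrightarrow> \<bar>f x - g x\<bar> \<le> M"
  shows "norm (fun_op A f - fun_op A g) \<le> M"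
  using fun_op_norm_le[of A "\<lambda>x. f x - g x" M] assms
  by (simp add: fun_op_diff continuous_on_diff)

lemma fun_op_commute:
  assumes "unit_op A" "continuous_on {0..1} f" and "T o\<^sub>L A = A o\<^sub>L T"
  shows "T o\<^sub>L fun_op A f = fun_op A f o\<^sub>L T"
proof (rule LIMSEQ_unique)
  show "(\<lambda>n. T o\<^sub>L poly_op (bern_poly n f) A) \<longlonglongrightarrow> (T o\<^sub>L fun_op A f)"
    using assms
    by (intro bounded_bilinear.tendsto[OF bounded_bilinear_blinfun_compose] tendsto_fun_op tendsto_const)
  have "(\<lambda>n. poly_op (bern_poly n f) A o\<^sub>L T) \<longlonglongrightarrow> (fun_op A f o\<^sub>L T)"
    using assms
    by (intro bounded_bilinear.tendsto[OF bounded_bilinear_blinfun_compose] tendsto_fun_op tendsto_const)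
  then show "(\<lambda>n. T o\<^sub>L poly_op (bern_poly n f) A) \<longlonglongrightarrow> (fun_op A f o\<^sub>L T)"
    by (simp add: poly_op_commute assms(3))
qed

lemma pos_op_fun_op:
  fixes A :: "'a::{real_inner,banach} \<Rightarrow>\<^sub>L 'a"
  assumes A: "unit_op A" and f: "continuous_on {0..1} f"
    and nonneg: "\<And>x. x \<in> {0..1} \<Longrightarrow> 0 \<le> f x"
  shows "pos_op (fun_op A f)"
proof -
  have "pos_op (poly_op (bern_poly n f) A)" for n
    unfolding bern_poly_def poly_op_sum poly_op_smult
    by (intro pos_op_sum pos_op_scaleR pos_op_bern A nonneg) (auto simp: divide_le_eq_1)
  then show ?thesis
    using closed_sequentially[OF closed_pos_op[where 'a='a], of "\<lambda>n. poly_op (bern_poly n f) A"]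
      tendsto_fun_op[OF A f] by auto
qed

lemma unit_op_fun_op:
  assumes A: "unit_op A" and f: "continuous_on {0..1} f"
    and unit: "\<And>x. x \<in> {0..1} \<Longrightarrow> f x \<in> {0..1}"
  shows "unit_op (fun_op A f)"
proof -
  have "pos_op (fun_op A (\<lambda>x. 1 - f x))"
    using A f unit by (intro pos_op_fun_op continuous_intros) auto
  then have "pos_op (id_blinfun - fun_op A f)"
    using A f by (simp add: fun_op_diff fun_op_const)
  moreover have "pos_op (fun_op A f)" using A f unit by (intro pos_op_fun_op) auto
  ultimately show ?thesis by (simp add: unit_op_def)
qed

lemma poly_op_fun_op:
  assumes A: "unit_op A" and g: "continuous_on {0..1} g"
  shows "poly_op p (fun_op A g) = fun_op A (\<lambda>x. poly p (g x))"
proof (induction p)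
  case 0
  then show ?case using fun_op_const[OF A, of 0] by simp
next
  case (pCons c p)
  then show ?case using A g
    by (simp add: fun_op_add fun_op_mult fun_op_const continuous_intros)
qed

lemma poly_op_eq_fun_op: "unit_op A \<Longrightarrow> poly_op p A = fun_op A (poly p)"
  using poly_op_fun_op[of A "\<lambda>x. x" p] by (simp add: fun_op_ident)

lemma bern_poly_uniform:
  assumes "continuous_on {0..1} f" "0 < e"
  shows "\<exists>N. \<forall>n\<ge>N. \<forall>x\<in>{0..1}. \<bar>f x - poly (bern_poly n f) x\<bar> < e"
  using Bernstein_Weierstrass[OF assms] unfolding poly_bern_poly by blast

lemma fun_op_comp:
  fixes A :: "'a::{real_inner,banach} \<Rightarrow>\<^sub>L 'a"
  assumes A: "unit_op A" and g: "continuous_on {0..1} g" and f: "continuous_on {0..1} f"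
    and unit: "\<And>x. x \<in> {0..1} \<Longrightarrow> g x \<in> {0..1}"
  shows "fun_op (fun_op A g) f = fun_op A (\<lambda>x. f (g x))"
proof (rule fun_op_eqI[OF unit_op_fun_op[OF A g unit] f])
  have fg: "continuous_on {0..1} (\<lambda>x. f (g x))"
    by (rule continuous_on_compose2[OF f g]) (use unit in auto)
  show "(\<lambda>n. poly_op (bern_poly n f) (fun_op A g)) \<longlonglongrightarrow> fun_op A (\<lambda>x. f (g x))"
    unfolding poly_op_fun_op[OF A g]
  proof (rule LIMSEQ_I)
    fix e :: real assume e: "0 < e"
    then obtain N where N: "\<And>n x. n \<ge> N \<Longrightarrow> x \<in> {0..1} \<Longrightarrow> \<bar>f x - poly (bern_poly n f) x\<bar> < e / 2"
      using bern_poly_uniform[OF f, of "e / 2"] by (meson half_gt_zero)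
    have "norm (fun_op A (\<lambda>x. poly (bern_poly n f) (g x)) - fun_op A (\<lambda>x. f (g x))) \<le> e / 2"
      if "n \<ge> N" for n
    proof (intro fun_op_dist_le A fg continuous_intros g)
      fix x :: real assume "x \<in> {0..1}"
      then show "\<bar>poly (bern_poly n f) (g x) - f (g x)\<bar> \<le> e / 2"
        using N[OF that unit] by (simp add: abs_minus_commute less_imp_le)
    qed
    moreover have half: "e / 2 < e" using e by simp
    ultimately show "\<exists>N. \<forall>n\<ge>N. norm (fun_op A (\<lambda>x. poly (bern_poly n f) (g x)) - fun_op A (\<lambda>x. f (g x))) < e"
      by (intro exI[of _ N] allI impI le_less_trans[OF _ half]) auto
  qed
qed

text \<open>
  The Bernstein approximation error does not depend on the operator, so \<open>A \<mapsto> f(A)\<close> is a uniform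
  limit of the norm-continuous maps \<open>A \<mapsto> p(A)\<close>.
\<close>

lemma fun_op_continuous:
  fixes A :: "'a::{real_inner,banach} \<Rightarrow>\<^sub>L 'a"
  assumes lim: "(B \<longlongrightarrow> A) G" and A: "unit_op A" and B: "\<forall>\<^sub>F \<tau> in G. unit_op (B \<tau>)"
    and f: "continuous_on {0..1} f"
  shows "((\<lambda>\<tau>. fun_op (B \<tau>) f) \<longlongrightarrow> fun_op A f) G"
proof (rule tendstoI)
  fix e :: real assume e: "0 < e"
  then have "0 < e / 3" by simp
  from bern_poly_uniform[OF f this] obtain n
    where n: "\<And>x. x \<in> {0..1} \<Longrightarrow> \<bar>f x - poly (bern_poly n f) x\<bar> < e / 3" by blast
  let ?p = "bern_poly n f"
  have approx: "norm (fun_op T f - poly_op ?p T) \<le> e / 3" if "unit_op T" for T :: "'a \<Rightarrow>\<^sub>L 'a"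
    unfolding poly_op_eq_fun_op[OF that]
    by (intro fun_op_dist_le that f less_imp_le[OF n] continuous_intros)
  have "\<forall>\<^sub>F \<tau> in G. norm (poly_op ?p (B \<tau>) - poly_op ?p A) < e / 3"
    using tendstoD[OF tendsto_poly_op[OF lim, of ?p], of "e / 3"] e by (simp add: dist_norm)
  with B show "\<forall>\<^sub>F \<tau> in G. dist (fun_op (B \<tau>) f) (fun_op A f) < e"
  proof eventually_elim
    case (elim \<tau>)
    have tri: "norm (a - d) \<le> norm (a - b) + norm (b - c) + norm (d - c)"
      for a b c d :: "'a \<Rightarrow>\<^sub>L 'a"
      using norm_triangle_ineq[of "a - b" "b - c"] norm_triangle_ineq4[of "a - c" "d - c"] by simp
    have "norm (fun_op (B \<tau>) f - fun_op A f) \<le> norm (fun_op (B \<tau>) f - poly_op ?p (B \<tau>))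
        + norm (poly_op ?p (B \<tau>) - poly_op ?p A) + norm (fun_op A f - poly_op ?p A)"
      by (rule tri)
    then show ?case using approx[OF elim(1)] approx[OF A] elim(2) by (simp add: dist_norm)
  qed
qed

section \<open>Complex Hilbert spaces\<close>

instance complex_hilbert \<subseteq> banach ..

lemma cinner_scaleC_left: "cinner (c *\<^sub>C x) y = cnj c * cinner x (y::'a::complex_hilbert)"
  by (metis cinner_commute cinner_scaleC_right complex_cnj_mult)

lemma norm_scaleC: "norm (c *\<^sub>C x) = cmod c * norm (x::'a::complex_hilbert)"
proof -
  have "cinner (c *\<^sub>C x) (c *\<^sub>C x) = complex_of_real ((cmod c)\<^sup>2) * cinner x x"
    by (simp add: cinner_scaleC_left cinner_scaleC_right complex_norm_square mult_ac del: of_real_power)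
  then have "Re (cinner (c *\<^sub>C x) (c *\<^sub>C x)) = (cmod c)\<^sup>2 * Re (cinner x x)"
    by (simp del: of_real_power)
  then have "(norm (c *\<^sub>C x))\<^sup>2 = (cmod c * norm x)\<^sup>2"
    by (simp add: Re_cinner dot_square_norm power_mult_distrib)
  then show ?thesis by simp
qed

lemma scaleR_scaleC_commute: "c *\<^sub>C (r *\<^sub>R x) = r *\<^sub>R (c *\<^sub>C (x::'a::complex_hilbert))"
  by (metis scaleC_of_real scaleC_scaleC mult.commute)

lemma bounded_linear_scaleC: "bounded_linear (\<lambda>x::'a::complex_hilbert. c *\<^sub>C x)"
  by (rule bounded_linear_intro[where K = "cmod c"])
    (simp_all add: scaleC_add_right scaleR_scaleC_commute norm_scaleC)

lemma scaleC_one [simp]: "1 *\<^sub>C x = (x::'a::complex_hilbert)"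
  using scaleC_of_real[of 1 x] by simp

lemma scaleC_minus_one [simp]: "(-1) *\<^sub>C x = - (x::'a::complex_hilbert)"
  using scaleC_of_real[of "-1" x] by simp

lemma Im_cinner: "Im (cinner x y) = - inner x (\<i> *\<^sub>C (y::'a::complex_hilbert))"
  by (simp add: Re_cinner[symmetric] cinner_scaleC_right)

lemma bounded_ops_iff_commute:
  "T \<in> bounded_ops \<longleftrightarrow> (\<forall>c. Blinfun (\<lambda>x. c *\<^sub>C x) o\<^sub>L T = T o\<^sub>L Blinfun (\<lambda>x. c *\<^sub>C x))"
  by (auto simp: bounded_ops_def blinfun_apply_inject[symmetric] fun_eq_iff
      bounded_linear_Blinfun_apply bounded_linear_scaleC)

lemma fun_op_bounded_ops:
  "unit_op A \<Longrightarrow> A \<in> bounded_ops \<Longrightarrow> continuous_on {0..1} f \<Longrightarrow> fun_op A f \<in> bounded_ops"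
  by (simp add: bounded_ops_iff_commute fun_op_commute)

lemma limitin_strong_operator_topology:
  "limitin strong_operator_topology f l F \<longleftrightarrow> (\<forall>x. ((\<lambda>t. blinfun_apply (f t) x) \<longlongrightarrow> blinfun_apply l x) F)"
proof -
  have "limitin strong_operator_topology f l F
      \<longleftrightarrow> limitin (euclidean :: ('a \<Rightarrow> 'b) topology) (\<lambda>t. blinfun_apply (f t)) (blinfun_apply l) F"
    unfolding limitin_def strong_operator_topology_def openin_pullback_topology topspace_pullback_topology
    by auto
  also have "\<dots> \<longleftrightarrow> (\<forall>x. ((\<lambda>t. blinfun_apply (f t) x) \<longlongrightarrow> blinfun_apply l x) F)"
    unfolding euclidean_product_topology[symmetric] limitin_componentwise by auto
  finally show ?thesis .
qed

text \<open>
  The vector is \<open>x - p\<close> for a point \<open>x\<close> outside the subspace and its nearest point \<open>p\<close>. A minimising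
  sequence is Cauchy by the parallelogram law.
\<close>

lemma orthogonal_vector_exists:
  fixes M :: "'a::{real_inner,banach} set"
  assumes M: "subspace M" "closed M" "M \<noteq> UNIV"
  obtains y where "y \<noteq> 0" "\<And>m. m \<in> M \<Longrightarrow> inner y m = 0"
proof -
  obtain x where x: "x \<notin> M" using M by auto
  have "M \<noteq> {}" using subspace_0[OF M(1)] by auto
  define d where "d = infdist x M"
  have d: "d \<le> norm (x - m)" if "m \<in> M" for m
    using infdist_le[OF that, of x] by (simp add: d_def dist_norm)
  have "0 \<le> d" by (simp add: d_def infdist_nonneg)
  have "\<exists>m\<in>M. (norm (x - m))\<^sup>2 < d\<^sup>2 + inverse (real (Suc n))" for n
  proof -
    have "d < sqrt (d\<^sup>2 + inverse (real (Suc n)))"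
      using \<open>0 \<le> d\<close> by (intro real_less_rsqrt) auto
    then obtain m where m: "m \<in> M" "dist x m < sqrt (d\<^sup>2 + inverse (real (Suc n)))"
      unfolding d_def infdist_notempty[OF \<open>M \<noteq> {}\<close>] using \<open>M \<noteq> {}\<close>
      by (subst (asm) cINF_less_iff) auto
    then have "(dist x m)\<^sup>2 < (sqrt (d\<^sup>2 + inverse (real (Suc n))))\<^sup>2"
      by (intro power_strict_mono) auto
    then show ?thesis using m(1) by (auto simp: dist_norm)
  qed
  then obtain m where m: "\<And>n. m n \<in> M" "\<And>n. (norm (x - m n))\<^sup>2 < d\<^sup>2 + inverse (real (Suc n))"
    by metis
  have gap: "(norm (m i - m j))\<^sup>2 \<le> 2 * inverse (real (Suc i)) + 2 * inverse (real (Suc j))" for i j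
  proof -
    let ?c = "(1/2) *\<^sub>R (m i + m j)"
    have "?c \<in> M" using m(1) M(1) by (intro subspace_scale subspace_add)
    then have "d\<^sup>2 \<le> (norm (x - ?c))\<^sup>2" using d \<open>0 \<le> d\<close> by (intro power_mono) auto
    moreover have "(norm (m i - m j))\<^sup>2
        = 2 * (norm (x - m i))\<^sup>2 + 2 * (norm (x - m j))\<^sup>2 - 4 * (norm (x - ?c))\<^sup>2"
      by (simp add: power2_norm_eq_inner inner_simps inner_commute algebra_simps)
    ultimately show ?thesis using m(2)[of i] m(2)[of j] by linarith
  qed
  have "Cauchy m"
  proof (rule CauchyI)
    fix e :: real assume e: "0 < e"
    then obtain N where N: "inverse (real (Suc N)) < e\<^sup>2 / 4"
      using reals_Archimedean[of "e\<^sup>2 / 4"] by auto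
    show "\<exists>M. \<forall>i\<ge>M. \<forall>j\<ge>M. norm (m i - m j) < e"
    proof (intro exI allI impI)
      fix i j assume ij: "N \<le> i" "N \<le> j"
      have "inverse (real (Suc i)) \<le> inverse (real (Suc N))" "inverse (real (Suc j)) \<le> inverse (real (Suc N))"
        using ij by (auto intro!: le_imp_inverse_le)
      then have "(norm (m i - m j))\<^sup>2 < e\<^sup>2" using gap[of i j] N by linarith
      then show "norm (m i - m j) < e" using e by (simp add: power2_less_imp_less)
    qed
  qed
  then obtain p where p: "m \<longlonglongrightarrow> p" by (auto simp: Cauchy_convergent_iff convergent_def)
  have "p \<in> M" using closed_sequentially[OF M(2)] m(1) p by blast
  have "(\<lambda>n. d\<^sup>2 + inverse (real (Suc n))) \<longlonglongrightarrow> d\<^sup>2 + 0"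
    by (intro tendsto_intros LIMSEQ_inverse_real_of_nat)
  moreover have "(\<lambda>n. (norm (x - m n))\<^sup>2) \<longlonglongrightarrow> (norm (x - p))\<^sup>2"
    by (intro tendsto_intros p)
  ultimately have best: "(norm (x - p))\<^sup>2 \<le> d\<^sup>2"
    using LIMSEQ_le[of "\<lambda>n. (norm (x - m n))\<^sup>2" _ "\<lambda>n. d\<^sup>2 + inverse (real (Suc n))"] m(2)
    by (metis (no_types, lifting) add.right_neutral less_imp_le)
  have "inner (x - p) v = 0" if v: "v \<in> M" for v
  proof (cases "v = 0")
    case False
    define t where "t = inner (x - p) v / inner v v"
    have "p + t *\<^sub>R v \<in> M" using \<open>p \<in> M\<close> v M(1) by (intro subspace_scale subspace_add)
    then have "d\<^sup>2 \<le> (norm (x - (p + t *\<^sub>R v)))\<^sup>2" using d \<open>0 \<le> d\<close> by (intro power_mono) auto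
    also have "\<dots> = (norm (x - p))\<^sup>2 - 2 * t * inner (x - p) v + t\<^sup>2 * inner v v"
      by (simp add: power2_norm_eq_inner inner_simps inner_commute algebra_simps power2_eq_square[of t])
    also have "\<dots> = (norm (x - p))\<^sup>2 - (inner (x - p) v)\<^sup>2 / inner v v"
      using False by (simp add: t_def power2_eq_square field_simps)
    finally have "(inner (x - p) v)\<^sup>2 / inner v v \<le> 0" using best by linarith
    then show ?thesis using False
      by (smt (verit) divide_pos_pos inner_gt_zero_iff power2_less_eq_zero_iff zero_less_power2)
  qed simp
  moreover have "x - p \<noteq> 0" using x \<open>p \<in> M\<close> by auto
  ultimately show thesis using that by blast
qed

section \<open>The resolvent of a non-negative self-adjoint operator\<close>

lemma op_graph_inject: "op_graph S = op_graph T \<Longrightarrow> S = T"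
  by (force simp: op_graph_def intro!: blinfun_eqI)

lemma inverse_op_eqI: "B \<in> bounded_ops \<Longrightarrow> op_graph B = A\<inverse> \<Longrightarrow> inverse_op A = B"
  unfolding inverse_op_def by (rule the_equality) (auto intro: op_graph_inject)

text \<open>
  The real parts suffice because the graph is stable under multiplication by \<open>\<i>\<close>, which turns
  imaginary parts into real parts.
\<close>

lemma cinner_eq_iff_inner:
  fixes y z :: "'a::complex_hilbert"
  assumes A: "linear_operator A"
  shows "(\<forall>(x, w)\<in>A. cinner y w = cinner z x) \<longleftrightarrow> (\<forall>(x, w)\<in>A. inner y w = inner z x)"
proof
  assume "\<forall>(x, w)\<in>A. cinner y w = cinner z x"
  then show "\<forall>(x, w)\<in>A. inner y w = inner z x" by (fastforce simp: Re_cinner[symmetric])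
next
  assume r: "\<forall>(x, w)\<in>A. inner y w = inner z x"
  have "cinner y w = cinner z x" if "(x, w) \<in> A" for x w
  proof -
    have "(\<i> *\<^sub>C x, \<i> *\<^sub>C w) \<in> A" using A that by (auto simp: linear_operator_def)
    then show ?thesis using r that by (auto simp: complex_eq_iff Re_cinner Im_cinner)
  qed
  then show "\<forall>(x, w)\<in>A. cinner y w = cinner z x" by auto
qed

lemma mem_adjoint_op_iff:
  "linear_operator A \<Longrightarrow> (y, z) \<in> adjoint_op A \<longleftrightarrow> (\<forall>(x, w)\<in>A. inner y w = inner z x)"
  by (simp add: adjoint_op_def cinner_eq_iff_inner)

lemma self_adjoint_memI:
  assumes "self_adjoint A" "\<And>x w. (x, w) \<in> A \<Longrightarrow> inner y w = inner z x"
  shows "(y, z) \<in> A"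
  using assms mem_adjoint_op_iff[of A y z] by (auto simp: self_adjoint_def)

lemma self_adjoint_symmetric:
  assumes "self_adjoint A" "(x, w) \<in> A" "(y, z) \<in> A"
  shows "inner y w = inner z x"
  using assms mem_adjoint_op_iff[of A y z] by (auto simp: self_adjoint_def)

lemma nonneg_op_inner: "nonneg_op A \<Longrightarrow> (x, y) \<in> A \<Longrightarrow> 0 \<le> inner x y"
  by (auto simp: nonneg_op_def Re_cinner[symmetric] complex_nonneg_Reals_iff)

lemma linear_operatorD:
  assumes "linear_operator A"
  shows "(0, 0) \<in> A"
    "(x, y) \<in> A \<Longrightarrow> (x', y') \<in> A \<Longrightarrow> (x + x', y + y') \<in> A"
    "(x, y) \<in> A \<Longrightarrow> (c *\<^sub>C x, c *\<^sub>C y) \<in> A"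
    "(x, y) \<in> A \<Longrightarrow> (r *\<^sub>R x, r *\<^sub>R y) \<in> A"
    "(x, y) \<in> A \<Longrightarrow> (x', y') \<in> A \<Longrightarrow> (x - x', y - y') \<in> A"
proof -
  have add: "(x, y) \<in> A \<Longrightarrow> (x', y') \<in> A \<Longrightarrow> (x + x', y + y') \<in> A"
    and scale: "(x, y) \<in> A \<Longrightarrow> (c *\<^sub>C x, c *\<^sub>C y) \<in> A" for x y x' y' c
    using assms unfolding linear_operator_def by blast+
  show "(0, 0) \<in> A" using assms by (simp add: linear_operator_def)
  show "(x, y) \<in> A \<Longrightarrow> (x', y') \<in> A \<Longrightarrow> (x + x', y + y') \<in> A"
    "(x, y) \<in> A \<Longrightarrow> (c *\<^sub>C x, c *\<^sub>C y) \<in> A" by (fact add, fact scale)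
  show "(x, y) \<in> A \<Longrightarrow> (r *\<^sub>R x, r *\<^sub>R y) \<in> A"
    using scale[of x y "complex_of_real r"] by (simp add: scaleC_of_real)
  show "(x - x', y - y') \<in> A" if "(x, y) \<in> A" "(x', y') \<in> A"
    using add[OF that(1) scale[OF that(2), of "-1"]] by simp
qed

lemma nonneg_op_norm_le:
  assumes "nonneg_op H" "(x, y) \<in> H"
  shows "norm x \<le> norm (x + y)"
proof (rule power2_le_imp_le)
  show "(norm x)\<^sup>2 \<le> (norm (x + y))\<^sup>2"
    using nonneg_op_inner[OF assms] by (simp add: power2_norm_eq_inner inner_simps inner_commute)
qed simp

text \<open>
  The range of \<open>1 + H\<close> is closed, since \<open>1 + H\<close> does not decrease norms and a self-adjoint graph
  is closed. A vector \<open>y\<close> orthogonal to the range lies in the domain with \<open>H y = - y\<close>, and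
  non-negativity of \<open>H\<close> forces \<open>y = 0\<close>.
\<close>

lemma one_plus_range:
  fixes H :: "'a::complex_hilbert operator"
  assumes H: "self_adjoint H" "nonneg_op H"
  shows "\<exists>x. (x, u - x) \<in> H"
proof -
  note lin = linear_operatorD[OF conjunct1[OF H(1)[unfolded self_adjoint_def]]]
  let ?M = "{u. \<exists>x. (x, u - x) \<in> H}"
  note expand = nonneg_op_norm_le[OF H(2)]
  have "subspace ?M"
  proof (rule subspaceI)
    show "0 \<in> ?M" using lin(1) by (auto intro!: exI[of _ 0])
    fix u v assume "u \<in> ?M" "v \<in> ?M"
    then obtain x y where "(x, u - x) \<in> H" "(y, v - y) \<in> H" by auto
    then have "(x + y, (u - x) + (v - y)) \<in> H" by (rule lin(2))
    then show "u + v \<in> ?M" by (auto simp: algebra_simps)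
  next
    fix c :: real and u assume "u \<in> ?M"
    then obtain x where "(x, u - x) \<in> H" by auto
    then have "(c *\<^sub>R x, c *\<^sub>R (u - x)) \<in> H" by (rule lin(4))
    then show "c *\<^sub>R u \<in> ?M" by (auto simp: algebra_simps)
  qed
  moreover have "closed ?M"
  proof (subst closed_sequential_limits, intro allI impI, elim conjE)
    fix u l assume u: "\<forall>n. u n \<in> ?M" and l: "u \<longlonglongrightarrow> l"
    then obtain x where x: "\<And>n. (x n, u n - x n) \<in> H" by auto metis
    have le: "norm (x i - x j) \<le> norm (u i - u j)" for i j
      using expand[OF lin(5)[OF x x], of i j] by simp
    have "Cauchy x"
      using LIMSEQ_imp_Cauchy[OF l] le unfolding Cauchy_iff by (meson le_less_trans)
    then obtain p where p: "x \<longlonglongrightarrow> p" by (auto simp: Cauchy_convergent_iff convergent_def)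
    have "(p, l - p) \<in> H"
    proof (rule self_adjoint_memI[OF H(1)])
      fix a w assume aw: "(a, w) \<in> H"
      have "(\<lambda>n. inner (x n) w) \<longlonglongrightarrow> inner p w" by (intro tendsto_intros p)
      moreover have "(\<lambda>n. inner (u n - x n) a) \<longlonglongrightarrow> inner (l - p) a" by (intro tendsto_intros p l)
      ultimately show "inner p w = inner (l - p) a"
        using self_adjoint_symmetric[OF H(1) aw x] LIMSEQ_unique by auto
    qed
    then show "l \<in> ?M" by blast
  qed
  moreover have "y = 0" if "\<And>m. m \<in> ?M \<Longrightarrow> inner y m = 0" for y
  proof -
    have "(y, - y) \<in> H"
    proof (rule self_adjoint_memI[OF H(1)])
      fix x w assume "(x, w) \<in> H"
      then have "x + w \<in> ?M" by (auto intro!: exI[of _ x])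
      then show "inner y w = inner (- y) x" using that[of "x + w"] by (simp add: inner_simps)
    qed
    then have "0 \<le> inner y (- y)" by (rule nonneg_op_inner[OF H(2)])
    then show "y = 0" by (simp add: inner_minus_right) (metis inner_ge_zero inner_eq_zero_iff order_antisym)
  qed
  ultimately have "?M = UNIV" by (metis (no_types, lifting) orthogonal_vector_exists)
  then show ?thesis by blast
qed

lemma resolvent:
  fixes H :: "'a::complex_hilbert operator"
  assumes H: "self_adjoint H" "nonneg_op H"
  defines "R \<equiv> inverse_op (one_plus_op H)"
  shows resolvent_bounded_ops: "R \<in> bounded_ops"
    and resolvent_mem: "(blinfun_apply R u, u - blinfun_apply R u) \<in> H"
    and resolvent_apply: "(x, y) \<in> H \<Longrightarrow> blinfun_apply R (x + y) = x"
    and resolvent_unit_op: "unit_op R"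
    and resolvent_dense: "closure (range (blinfun_apply R)) = UNIV"
proof -
  note lin = linear_operatorD[OF conjunct1[OF H(1)[unfolded self_adjoint_def]]]
  note expand = nonneg_op_norm_le[OF H(2)]
  obtain r where r: "\<And>u. (r u, u - r u) \<in> H"
    using one_plus_range[OF H] by metis
  have r_eq: "r (x + y) = x" if "(x, y) \<in> H" for x y
  proof -
    have "norm (r (x + y) - x) \<le> norm (r (x + y) - x + (x + y - r (x + y) - y))"
      by (rule expand[OF lin(5)[OF r that]])
    then show ?thesis by simp
  qed
  have "bounded_linear r"
  proof (rule bounded_linear_intro[where K = 1])
    fix u v :: 'a and c :: real
    show "r (u + v) = r u + r v"
      using r_eq[OF lin(2)[OF r r], of u v] by (simp add: algebra_simps)
    show "r (c *\<^sub>R u) = c *\<^sub>R r u"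
      using r_eq[OF lin(4)[OF r], of c u] by (simp add: algebra_simps)
    show "norm (r u) \<le> norm u * 1" using expand[OF r, of u] by simp
  qed
  then have app: "blinfun_apply (Blinfun r) = r" by (rule bounded_linear_Blinfun_apply)
  have C: "Blinfun r \<in> bounded_ops"
    unfolding bounded_ops_def mem_Collect_eq app
  proof (intro allI)
    fix c u show "r (c *\<^sub>C u) = c *\<^sub>C r u"
      using r_eq[OF lin(3)[OF r], of c u] by (simp add: scaleC_add_right[symmetric])
  qed
  have "(a, b) \<in> op_graph (Blinfun r) \<longleftrightarrow> (b, a) \<in> one_plus_op H" for a b
  proof
    assume "(a, b) \<in> op_graph (Blinfun r)"
    then have "b = r a" by (auto simp: op_graph_def app)
    then show "(b, a) \<in> one_plus_op H" using r[of a] by (force simp: one_plus_op_def)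
  next
    assume "(b, a) \<in> one_plus_op H"
    then show "(a, b) \<in> op_graph (Blinfun r)" by (auto simp: one_plus_op_def op_graph_def app r_eq)
  qed
  then have "op_graph (Blinfun r) = (one_plus_op H)\<inverse>" by auto
  then have "R = Blinfun r" unfolding R_def by (intro inverse_op_eqI C)
  then have R: "blinfun_apply R = r" by (simp add: app)
  show "R \<in> bounded_ops" using C \<open>R = Blinfun r\<close> by simp
  show "(blinfun_apply R u, u - blinfun_apply R u) \<in> H" by (simp add: R r)
  show "(x, y) \<in> H \<Longrightarrow> blinfun_apply R (x + y) = x" by (simp add: R r_eq)
  show "unit_op R"
  proof (rule unit_opI; unfold R)
    fix u v
    show "inner (r u) v = inner u (r v)"
      using self_adjoint_symmetric[OF H(1) r[of u] r[of v]] by (simp add: inner_simps inner_commute)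
    show "0 \<le> inner u (r u)"
      using nonneg_op_inner[OF H(2) r[of u]]
      by (simp add: inner_simps inner_commute) (metis inner_ge_zero order_trans)
    show "norm (r u) \<le> norm u" using expand[OF r, of u] by simp
  qed
  have "Domain H \<subseteq> range r"
  proof
    fix x assume "x \<in> Domain H"
    then obtain y where "(x, y) \<in> H" by auto
    then show "x \<in> range r" using r_eq by (metis rangeI)
  qed
  moreover have "closure (Domain H) = UNIV"
    using H(1) by (simp add: self_adjoint_def densely_defined_def)
  ultimately show "closure (range (blinfun_apply R)) = UNIV"
    unfolding R using closure_mono by blast
qed

section \<open>Strongly continuous semigroups\<close>

text \<open>
  The Banach-Steinhaus theorem for sequences, by Baire's theorem: one of the closed sets on which
  all \<open>T n\<close> are bounded by \<open>k\<close> contains a ball.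
\<close>

lemma uniform_boundedness:
  fixes T :: "nat \<Rightarrow> ('a::banach \<Rightarrow>\<^sub>L 'b::real_normed_vector)"
  assumes bdd: "\<And>x. Bseq (\<lambda>n. T n x)"
  shows "\<exists>M. \<forall>n. norm (T n) \<le> M"
proof -
  define E where "E k = {x. \<forall>n. norm (T n x) \<le> real k}" for k :: nat
  have "closed (E k)" for k
    unfolding E_def by (intro closed_Collect_all closed_Collect_le continuous_intros)
  moreover have "\<Union>(range E) = UNIV"
  proof -
    have "\<exists>k. x \<in> E k" for x
    proof -
      obtain K where "\<And>n. norm (T n x) \<le> K" using bdd[of x] by (auto simp: Bseq_def)
      moreover obtain k :: nat where "K \<le> k" using real_arch_simple by blast
      ultimately show ?thesis unfolding E_def by (blast intro: order_trans)
    qed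
    then show ?thesis by blast
  qed
  ultimately have "\<exists>k. interior (E k) \<noteq> {}"
    using Baire_category_alt[of "euclidean :: 'a topology" "range E"] completely_metrizable_space_euclidean
    by fastforce
  then obtain k x r where r: "0 < r" "cball x r \<subseteq> E k"
    by (meson ex_in_conv mem_interior_cball)
  have "norm (T n v) \<le> (2 * real k / r) * norm v" for n v
  proof (cases "v = 0")
    case False
    define w where "w = (r / norm v) *\<^sub>R v"
    have "norm w = r" using False r(1) by (simp add: w_def)
    then have "x \<in> E k" "x + w \<in> E k" using r by (auto simp: subset_iff dist_norm)
    then have "norm (T n x) \<le> k" "norm (T n (x + w)) \<le> k" by (auto simp: E_def)
    then have "norm (T n w) \<le> 2 * k"
      using norm_triangle_ineq4[of "T n (x + w)" "T n x"] by (simp add: blinfun.bilinear_simps)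
    moreover have "norm (T n w) = r / norm v * norm (T n v)"
      using r(1) by (simp add: w_def blinfun.bilinear_simps)
    ultimately show ?thesis using False r(1) by (simp add: field_simps)
  qed simp
  then have "norm (T n) \<le> 2 * real k / r" for n
    using r(1) by (intro norm_blinfun_bound) auto
  then show ?thesis by blast
qed

lemma tendsto_on_dense:
  fixes T :: "'i \<Rightarrow> ('a::real_normed_vector \<Rightarrow>\<^sub>L 'b::real_normed_vector)"
  assumes M: "\<forall>\<^sub>F \<tau> in F. norm (T \<tau>) \<le> M" and D: "closure D = UNIV"
    and lim: "\<And>x. x \<in> D \<Longrightarrow> ((\<lambda>\<tau>. T \<tau> x) \<longlongrightarrow> blinfun_apply L x) F"
  shows "((\<lambda>\<tau>. T \<tau> x) \<longlongrightarrow> blinfun_apply L x) F"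
proof (rule tendstoI)
  fix e :: real assume e: "0 < e"
  define K where "K = \<bar>M\<bar> + norm L + 1"
  have "0 < K" unfolding K_def by (smt (verit) norm_ge_zero)
  have "x \<in> closure D" using D by simp
  then obtain z where z: "z \<in> D" "dist z x < e / (2 * K)"
    using e \<open>0 < K\<close> by (metis closure_approachable divide_pos_pos mult_pos_pos zero_less_numeral)
  have "\<forall>\<^sub>F \<tau> in F. dist (T \<tau> z) (L z) < e / 2"
    by (rule tendstoD[OF lim[OF z(1)]]) (use e in simp)
  with M show "\<forall>\<^sub>F \<tau> in F. dist (T \<tau> x) (L x) < e"
  proof eventually_elim
    case (elim \<tau>)
    have "T \<tau> x - L x = (T \<tau> - L) (x - z) + (T \<tau> z - L z)"
      by (simp add: blinfun.bilinear_simps)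
    then have "norm (T \<tau> x - L x) \<le> norm ((T \<tau> - L) (x - z)) + norm (T \<tau> z - L z)"
      by (metis norm_triangle_ineq)
    also have "norm ((T \<tau> - L) (x - z)) \<le> K * norm (x - z)"
    proof -
      have "norm (T \<tau> - L) \<le> K"
        using norm_triangle_ineq4[of "T \<tau>" L] elim(1) unfolding K_def by linarith
      then show ?thesis
        by (meson norm_blinfun mult_right_mono norm_ge_zero order_trans)
    qed
    also have "K * norm (x - z) < e / 2"
      using z(2) \<open>0 < K\<close> by (simp add: dist_norm norm_minus_commute field_simps)
    finally show ?case using elim(2) by (simp add: dist_norm)
  qed
qed

text \<open>
  Otherwise there are times \<open>s\<^sub>n \<rightarrow> 0\<close> with \<open>norm (U s\<^sub>n)\<close> unbounded, although \<open>U s\<^sub>n x \<rightarrow> x\<close> for every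
  \<open>x\<close>, against uniform boundedness.
\<close>

lemma C0_semigroup_locally_bounded:
  fixes U :: "real \<Rightarrow> ('a::complex_hilbert \<Rightarrow>\<^sub>L 'a)"
  assumes U: "C0_semigroup U"
  obtains \<delta> M where "0 < \<delta>" "\<And>s. 0 \<le> s \<Longrightarrow> s \<le> \<delta> \<Longrightarrow> norm (U s) \<le> M"
proof (rule ccontr)
  assume neg: "\<not> thesis"
  have "\<exists>s\<ge>0. s \<le> inverse (real (Suc n)) \<and> \<not> norm (U s) \<le> real (Suc n)" for n
  proof (rule ccontr)
    assume "\<not> ?thesis"
    then have "norm (U s) \<le> real (Suc n)" if "0 \<le> s" "s \<le> inverse (real (Suc n))" for s
      using that by blast
    moreover have "0 < inverse (real (Suc n))" by simp
    ultimately have thesis by (rule that[rotated])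
    then show False using neg by simp
  qed
  then obtain s where s: "\<And>n. 0 \<le> s n" "\<And>n. s n \<le> inverse (real (Suc n))"
    "\<And>n. real (Suc n) < norm (U (s n))"
    by (metis not_le)
  have "s n \<noteq> 0" for n
  proof
    assume "s n = 0"
    then have "norm (U (s n)) \<le> 1" using U by (simp add: C0_semigroup_def norm_id_blinfun_le)
    then show False using s(3)[of n] by simp
  qed
  moreover have "s \<longlonglongrightarrow> 0"
    by (rule tendsto_sandwich[OF _ _ tendsto_const LIMSEQ_inverse_real_of_nat]) (auto simp: s simp del: of_nat_Suc)
  ultimately have lim: "filterlim s (at_right 0) sequentially"
    using s(1) by (intro tendsto_imp_filterlim_at_right) (auto simp: order_less_le)
  have "Bseq (\<lambda>n. U (s n) x)" for x
  proof -
    have "((\<lambda>h. U h x) \<longlongrightarrow> x) (at_right 0)"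
      using U by (simp add: C0_semigroup_def limitin_strong_operator_topology)
    then have "(\<lambda>n. U (s n) x) \<longlonglongrightarrow> x" using lim by (rule filterlim_compose)
    then show ?thesis by (metis convergent_def convergent_imp_Bseq)
  qed
  from uniform_boundedness[OF this] obtain M where M: "\<And>n. norm (U (s n)) \<le> M" by blast
  obtain n :: nat where "M \<le> n" using real_arch_simple by blast
  then show False using M[of n] s(3)[of n] by simp
qed

lemma generator_invariant:
  assumes U: "C0_semigroup U" and xy: "(x, y) \<in> generator U" and t: "0 \<le> t"
  shows "(blinfun_apply (U t) x, blinfun_apply (U t) y) \<in> generator U"
proof -
  have comm: "U h (U t x) = U t (U h x)" if "0 < h" for h x
  proof -
    have "U (h + t) = U h o\<^sub>L U t" "U (t + h) = U t o\<^sub>L U h"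
      using U t that unfolding C0_semigroup_def by auto
    then show ?thesis by (metis add.commute blinfun_apply_blinfun_compose)
  qed
  have "((\<lambda>h. U t ((U h x - x) /\<^sub>R h)) \<longlongrightarrow> U t y) (at_right 0)"
    using xy by (intro tendsto_intros) (simp add: generator_def)
  moreover have "\<forall>\<^sub>F h in at_right 0. U t ((U h x - x) /\<^sub>R h) = (U h (U t x) - U t x) /\<^sub>R h"
    using eventually_at_right_less[of "0::real"]
    by eventually_elim (simp add: comm blinfun.bilinear_simps)
  ultimately show ?thesis
    unfolding generator_def mem_Collect_eq prod.case by (rule Lim_transform_eventually)
qed

lemma C0_semigroup_multiple:
  assumes "C0_semigroup U" "0 \<le> h"
  shows "U (real (Suc n) * h) = U (real n * h) o\<^sub>L U h"
proof -
  have "U (real n * h + h) = U (real n * h) o\<^sub>L U h"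
    using assms unfolding C0_semigroup_def by simp
  then show ?thesis by (simp add: algebra_simps)
qed

section \<open>The exponential of a non-negative self-adjoint operator\<close>

lemma continuous_on_extend_by_zero:
  fixes g :: "real \<Rightarrow> real"
  assumes g: "continuous_on {0<..} g" and lim: "(g \<longlongrightarrow> 0) (at_right 0)"
  shows "continuous_on {0..1} (\<lambda>r. if r \<le> 0 then 0 else g r)" (is "continuous_on _ ?f")
  unfolding continuous_on_eq_continuous_within
proof
  fix r :: real assume r: "r \<in> {0..1}"
  show "continuous (at r within {0..1}) ?f"
  proof (cases "r = 0")
    case True
    have "(?f \<longlongrightarrow> 0) (at_right 0)"
    proof (rule Lim_transform_eventually[OF lim])
      show "\<forall>\<^sub>F x in at_right 0. g x = ?f x"
        using eventually_at_right_less[of "0::real"] by eventually_elim simp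
    qed
    then show ?thesis using True
      by (simp add: continuous_within at_within_Icc_at_right)
  next
    case False
    then have "0 < r" using r by simp
    have "isCont g r" using g \<open>0 < r\<close> by (simp add: continuous_on_eq_continuous_at)
    moreover have "\<forall>\<^sub>F x in nhds r. ?f x = g x"
      using eventually_nhds_in_open[of "{0<..}" r] \<open>0 < r\<close>
      by (auto elim: eventually_mono)
    ultimately have "isCont ?f r" using isCont_cong[of ?f g r] by simp
    then show ?thesis by (rule continuous_at_imp_continuous_at_within)
  qed
qed

text \<open>
  With \<open>r = 1 / (1 + \<lambda>)\<close> this is \<open>exp (- t \<lambda>)\<close>; the value 0 at \<open>r = 0\<close> corresponds to \<open>\<lambda> = \<infinity>\<close>.
  Thus \<open>heat_fun t\<close> applied to \<open>(1 + H)\<inverse>\<close> is \<open>exp (- t H)\<close>, and it is continuous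
  on the unit interval exactly because \<open>t > 0\<close>.
\<close>

definition heat_fun :: "real \<Rightarrow> real \<Rightarrow> real" where
  "heat_fun t r = (if r \<le> 0 then 0 else exp (- t * (1 / r - 1)))"

lemma continuous_heat_fun: "0 < t \<Longrightarrow> continuous_on {0..1} (heat_fun t)"
  unfolding heat_fun_def
proof (rule continuous_on_extend_by_zero)
  assume "0 < t"
  then show "((\<lambda>r. exp (- t * (1 / r - 1))) \<longlongrightarrow> 0) (at_right 0)" by real_asymp
qed (auto intro!: continuous_intros)

lemma heat_fun_in_unit: "0 \<le> t \<Longrightarrow> r \<in> {0..1} \<Longrightarrow> heat_fun t r \<in> {0..1}"
  by (auto simp: heat_fun_def)

lemma heat_fun_add: "heat_fun (s + t) r = heat_fun s r * heat_fun t r"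
  by (auto simp: heat_fun_def exp_add[symmetric] algebra_simps)

lemma exp_minus_bounds:
  fixes w :: real
  assumes "0 \<le> w"
  shows "1 - w \<le> exp (- w)" "exp (- w) \<le> 1 - w + w\<^sup>2"
proof -
  show "1 - w \<le> exp (- w)" using exp_ge_add_one_self[of "- w"] by simp
  have "exp (- w) \<le> 1 / (1 + w)"
    using exp_ge_add_one_self[of w] assms by (simp add: exp_minus field_simps)
  also have "\<dots> \<le> 1 - w + w\<^sup>2"
    using assms by (simp add: field_simps power2_eq_square power3_eq_cube)
  finally show "exp (- w) \<le> 1 - w + w\<^sup>2" .
qed

text \<open>
  The difference quotient of \<open>exp (- h \<lambda>)\<close> converges to \<open>- \<lambda>\<close> only pointwise in \<open>\<lambda>\<close>. A factor
  \<open>r = 1 / (1 + \<lambda>)\<close> makes it bounded uniformly in \<open>h\<close>, and a second one makes the convergence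
  uniform. In terms of operators, it converges in norm on the range of \<open>R\<^sup>2\<close>, and the uniform bound
  carries strong convergence over to the range of \<open>R\<close>, the domain of \<open>H\<close>.
\<close>

lemma heat_fun_difference_quotient:
  assumes h: "0 < h" and r: "r \<in> {0..1}"
  shows "\<bar>heat_fun h r * r - r\<bar> \<le> h"
    and "\<bar>(1 / h * (heat_fun h r * r - r) - (r - 1)) * r\<bar> \<le> h"
proof -
  show "\<bar>heat_fun h r * r - r\<bar> \<le> h" "\<bar>(1 / h * (heat_fun h r * r - r) - (r - 1)) * r\<bar> \<le> h"
  proof (atomize (full), cases "r = 0")
    case False
    define w where "w = h * (1 / r - 1)"
    have "0 < r" "r \<le> 1" using r False by auto
    have w: "0 \<le> w" "r * w = h * (1 - r)" using \<open>0 < r\<close> \<open>r \<le> 1\<close> h by (auto simp: w_def field_simps)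
    have hf: "heat_fun h r = exp (- w)" using \<open>0 < r\<close> by (simp add: heat_fun_def w_def)
    have "\<bar>exp (- w) * r - r\<bar> = r * (1 - exp (- w))"
      using \<open>0 < r\<close> w by (simp add: algebra_simps abs_if)
    also have "\<dots> \<le> r * w" using exp_minus_bounds(1)[OF w(1)] \<open>0 < r\<close> by (intro mult_left_mono) auto
    also have "\<dots> \<le> h" unfolding w(2) using h \<open>0 < r\<close> by (simp add: mult_left_le)
    finally have 1: "\<bar>heat_fun h r * r - r\<bar> \<le> h" by (simp add: hf)
    have "(1 / h * (exp (- w) * r - r) - (r - 1)) * r = r\<^sup>2 / h * (exp (- w) - (1 - w))"
    proof -
      have "h * ((1 / h * (exp (- w) * r - r) - (r - 1)) * r) = r\<^sup>2 * (exp (- w) - 1) + r * (h * (1 - r))"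
        using h by (simp add: field_simps power2_eq_square)
      also have "\<dots> = r\<^sup>2 * (exp (- w) - (1 - w))"
        unfolding w(2)[symmetric] by (simp add: algebra_simps power2_eq_square)
      finally have *: "h * ((1 / h * (exp (- w) * r - r) - (r - 1)) * r) = r\<^sup>2 * (exp (- w) - (1 - w))" .
      have "a = q / h * b" if "h * a = q * b" for a b q :: real
        using that h by (simp add: field_simps)
      then show ?thesis using * by blast
    qed
    moreover have "0 \<le> r\<^sup>2 / h * (exp (- w) - (1 - w))"
      using exp_minus_bounds(1)[OF w(1)] h by simp
    moreover have "r\<^sup>2 / h * (exp (- w) - (1 - w)) \<le> r\<^sup>2 / h * w\<^sup>2"
      using exp_minus_bounds(2)[OF w(1)] h by (intro mult_left_mono) auto
    moreover have "r\<^sup>2 / h * w\<^sup>2 = h * (1 - r)\<^sup>2"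
    proof -
      have "r\<^sup>2 / h * w\<^sup>2 = (r * w)\<^sup>2 / h" by (simp add: power_mult_distrib)
      then show ?thesis using h by (simp add: w(2) power2_eq_square)
    qed
    moreover have "h * (1 - r)\<^sup>2 \<le> h"
      using h \<open>0 < r\<close> \<open>r \<le> 1\<close> by (simp add: mult_left_le power_le_one)
    ultimately have "\<bar>(1 / h * (exp (- w) * r - r) - (r - 1)) * r\<bar> \<le> h"
      by (metis abs_of_nonneg order_trans)
    then show "\<bar>heat_fun h r * r - r\<bar> \<le> h
        \<and> \<bar>(1 / h * (heat_fun h r * r - r) - (r - 1)) * r\<bar> \<le> h"
      using 1 unfolding hf by blast
  qed (use h in simp)
qed

locale nonneg_self_adjoint =
  fixes H :: "'a::complex_hilbert operator"
  assumes self_adjoint: "self_adjoint H" and nonneg: "nonneg_op H"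
begin

definition R :: "'a \<Rightarrow>\<^sub>L 'a" where
  "R = inverse_op (one_plus_op H)"

lemmas R_bounded_ops = resolvent_bounded_ops[OF self_adjoint nonneg, folded R_def]
lemmas R_mem = resolvent_mem[OF self_adjoint nonneg, folded R_def]
lemmas R_apply = resolvent_apply[OF self_adjoint nonneg, folded R_def]
lemmas R_unit_op = resolvent_unit_op[OF self_adjoint nonneg, folded R_def]
lemmas R_dense = resolvent_dense[OF self_adjoint nonneg, folded R_def]
lemma mem_iff: "(x, y) \<in> H \<longleftrightarrow> (\<exists>u. x = R u \<and> y = u - R u)"
proof
  assume "(x, y) \<in> H"
  then show "\<exists>u. x = R u \<and> y = u - R u" using R_apply by (intro exI[of _ "x + y"]) simp
qed (use R_mem in blast)

lemma Domain_dense: "closure (Domain H) = UNIV"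
  using self_adjoint by (simp add: self_adjoint_def densely_defined_def)

text \<open>
  The value at \<open>t = 0\<close> is set apart since \<open>heat_fun 0\<close> jumps at 0.
\<close>

definition heat :: "real \<Rightarrow> 'a \<Rightarrow>\<^sub>L 'a" where
  "heat t = (if t \<le> 0 then id_blinfun else fun_op R (heat_fun t))"

lemma heat_eq: "0 < t \<Longrightarrow> heat t = fun_op R (heat_fun t)"
  by (simp add: heat_def)

lemma heat_bounded_ops: "heat t \<in> bounded_ops"
  using fun_op_bounded_ops[OF R_unit_op R_bounded_ops continuous_heat_fun]
  by (auto simp: heat_def bounded_ops_def)

lemma heat_add:
  assumes "0 \<le> s" "0 \<le> t" shows "heat (s + t) = heat s o\<^sub>L heat t"
proof (cases "s = 0 \<or> t = 0")
  case False
  then have "0 < s" "0 < t" using assms by auto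
  moreover have "fun_op R (heat_fun (s + t)) = fun_op R (\<lambda>r. heat_fun s r * heat_fun t r)"
    by (rule fun_op_cong) (rule heat_fun_add)
  ultimately show ?thesis
    by (simp add: heat_eq fun_op_mult R_unit_op continuous_heat_fun)
qed (auto simp: heat_def)

lemma norm_heat_le: "norm (heat t) \<le> 1"
proof (cases "t \<le> 0")
  case False
  then show ?thesis
    using heat_fun_in_unit[of t]
    by (simp add: heat_eq) (intro fun_op_norm_le R_unit_op continuous_heat_fun, auto)
qed (simp add: heat_def norm_id_blinfun_le)

lemma continuous_heat_fun_diff:
  "0 < h \<Longrightarrow> continuous_on {0..1} (\<lambda>r. heat_fun h r * r - r)"
  by (intro continuous_on_diff continuous_on_mult continuous_heat_fun continuous_on_id)

lemma heat_R_diff: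
  assumes h: "0 < h"
  shows "heat h (R v) - R v = fun_op R (\<lambda>r. heat_fun h r * r - r) v"
proof -
  have "fun_op R (\<lambda>r. heat_fun h r * r - r) = (heat h o\<^sub>L R) - R"
    by (simp only: fun_op_diff[OF R_unit_op continuous_on_mult[OF continuous_heat_fun[OF h] continuous_on_id]
          continuous_on_id] fun_op_mult[OF R_unit_op continuous_heat_fun[OF h] continuous_on_id]
        fun_op_ident[OF R_unit_op] heat_eq[OF h])
  then show ?thesis by (simp add: blinfun.bilinear_simps)
qed

lemma heat_tendsto: "((\<lambda>h. heat h x) \<longlongrightarrow> x) (at_right 0)"
proof -
  have "((\<lambda>h. heat h x) \<longlongrightarrow> id_blinfun x) (at_right 0)"
  proof (rule tendsto_on_dense[where D = "range R" and M = 1])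
    fix x assume "x \<in> range R"
    then obtain v where v: "x = R v" by auto
    have "\<forall>\<^sub>F h in at_right 0. norm (heat h x - x) \<le> h * norm v"
      using eventually_at_right_less[of "0::real"]
    proof eventually_elim
      case (elim h)
      have "norm (fun_op R (\<lambda>r. heat_fun h r * r - r)) \<le> h"
        by (rule fun_op_norm_le[OF R_unit_op continuous_heat_fun_diff[OF elim]
            heat_fun_difference_quotient(1)[OF elim]])
      then have "norm (heat h x - x) \<le> h * norm v"
        unfolding v heat_R_diff[OF elim] by (meson norm_blinfun mult_right_mono norm_ge_zero order_trans)
      then show ?case using elim by simp
    qed
    moreover have "((\<lambda>h. h * norm v) \<longlongrightarrow> 0) (at_right 0)"
      by (auto intro!: tendsto_eq_intros)
    ultimately have "((\<lambda>h. heat h x - x) \<longlongrightarrow> 0) (at_right 0)"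
      by (rule Lim_null_comparison)
    then show "((\<lambda>h. heat h x) \<longlongrightarrow> id_blinfun x) (at_right 0)"
      by (simp add: LIM_zero_iff)
  qed (simp_all add: norm_heat_le R_dense)
  then show ?thesis by simp
qed

lemma C0_semigroup_heat: "C0_semigroup heat"
  by (simp add: C0_semigroup_def heat_bounded_ops heat_add limitin_strong_operator_topology
      heat_tendsto) (simp add: heat_def)

lemma heat_difference_quotient:
  assumes "(x, y) \<in> H"
  shows "((\<lambda>h. (heat h x - x) /\<^sub>R h) \<longlongrightarrow> - y) (at_right 0)"
proof -
  obtain u where u: "x = R u" "y = u - R u" using assms mem_iff by blast
  define Q where "Q h = fun_op R (\<lambda>r. 1 / h * (heat_fun h r * r - r))" for h
  have Qdiff: "Q h v = (heat h (R v) - R v) /\<^sub>R h" if "0 < h" for h v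
    using that unfolding Q_def heat_R_diff[OF that]
    by (simp add: fun_op_scaleR[OF R_unit_op continuous_heat_fun_diff[OF that]]
        blinfun.bilinear_simps divide_inverse)
  have "((\<lambda>h. Q h u) \<longlongrightarrow> (R - id_blinfun) u) (at_right 0)"
  proof (rule tendsto_on_dense[where D = "range R" and M = 1])
    show "\<forall>\<^sub>F h in at_right 0. norm (Q h) \<le> 1"
      using eventually_at_right_less[of "0::real"]
    proof eventually_elim
      case (elim h)
      show ?case unfolding Q_def
      proof (rule fun_op_norm_le[OF R_unit_op
            continuous_on_mult[OF continuous_on_const continuous_heat_fun_diff[OF elim]]])
        fix r :: real assume "r \<in> {0..1}"
        then show "\<bar>1 / h * (heat_fun h r * r - r)\<bar> \<le> 1"
          using heat_fun_difference_quotient(1)[OF elim] elim by (simp add: abs_mult)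
      qed
    qed
    fix x assume "x \<in> range R"
    then obtain v where v: "x = R v" by auto
    have "\<forall>\<^sub>F h in at_right 0. norm (Q h x - (R - id_blinfun) x) \<le> h * norm v"
      using eventually_at_right_less[of "0::real"]
    proof eventually_elim
      case (elim h)
      have c: "continuous_on {0..1} (\<lambda>r. 1 / h * (heat_fun h r * r - r))"
        by (intro continuous_on_mult continuous_on_const continuous_heat_fun_diff elim)
      have c': "continuous_on {0..1} (\<lambda>r::real. r - 1)" by (intro continuous_intros)
      have c'': "continuous_on {0..1} (\<lambda>r. 1 / h * (heat_fun h r * r - r) - (r - 1))"
        by (intro continuous_on_diff c c')
      have "fun_op R (\<lambda>r. (1 / h * (heat_fun h r * r - r) - (r - 1)) * r)
         = (Q h - (R - id_blinfun)) o\<^sub>L R"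
        unfolding fun_op_mult[OF R_unit_op c'' continuous_on_id] fun_op_diff[OF R_unit_op c c']
          fun_op_diff[OF R_unit_op continuous_on_id continuous_on_const]
          fun_op_ident[OF R_unit_op] fun_op_const[OF R_unit_op] Q_def scaleR_one ..
      moreover have "norm (fun_op R (\<lambda>r. (1 / h * (heat_fun h r * r - r) - (r - 1)) * r)) \<le> h"
        by (rule fun_op_norm_le[OF R_unit_op continuous_on_mult[OF c'' continuous_on_id]
            heat_fun_difference_quotient(2)[OF elim]])
      ultimately have "norm ((Q h - (R - id_blinfun)) o\<^sub>L R) \<le> h" by simp
      then have "norm (((Q h - (R - id_blinfun)) o\<^sub>L R) v) \<le> h * norm v"
        by (rule order_trans[OF norm_blinfun mult_right_mono]) simp
      then show ?case using elim by (simp add: v blinfun.bilinear_simps)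
    qed
    moreover have "((\<lambda>h. h * norm v) \<longlongrightarrow> 0) (at_right 0)"
      by (auto intro!: tendsto_eq_intros)
    ultimately have "((\<lambda>h. Q h x - (R - id_blinfun) x) \<longlongrightarrow> 0) (at_right 0)"
      by (rule Lim_null_comparison)
    then show "((\<lambda>h. Q h x) \<longlongrightarrow> (R - id_blinfun) x) (at_right 0)"
      by (simp add: LIM_zero_iff)
  qed (rule R_dense)
  then have "((\<lambda>h. Q h u) \<longlongrightarrow> - y) (at_right 0)"
    by (simp add: u blinfun.bilinear_simps)
  moreover have "\<forall>\<^sub>F h in at_right 0. Q h u = (heat h x - x) /\<^sub>R h"
    using eventually_at_right_less[of "0::real"] by eventually_elim (simp add: Qdiff u)
  ultimately show ?thesis by (rule Lim_transform_eventually)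
qed

text \<open>
  The generator extends \<open>- H\<close>. If it takes \<open>x\<close> to \<open>y\<close>, let \<open>w\<close> solve \<open>w + H w = x - y\<close>, so that
  \<open>d = x - w\<close> is mapped to itself by the generator. Since the
  semigroup is contractive the generator is dissipative, hence \<open>\<langle>d, d\<rangle> \<le> 0\<close> and \<open>x = w\<close> is in the
  domain of \<open>H\<close>.
\<close>

lemma generator_heat: "generator heat = uminus_op H"
proof
  show "uminus_op H \<subseteq> generator heat"
    using heat_difference_quotient by (auto simp: uminus_op_def generator_def)
  show "generator heat \<subseteq> uminus_op H"
  proof (rule subrelI)
    fix x y assume "(x, y) \<in> generator heat"
    then have xy: "((\<lambda>h. (heat h x - x) /\<^sub>R h) \<longlongrightarrow> y) (at_right 0)" by (simp add: generator_def)
    define w where "w = R (x - y)"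
    define d where "d = x - w"
    have Hw: "(w, x - y - w) \<in> H" unfolding w_def by (rule R_mem)
    have quot: "(heat h x - x) /\<^sub>R h - (heat h w - w) /\<^sub>R h = (heat h d - d) /\<^sub>R h" for h
      by (simp add: d_def blinfun.bilinear_simps algebra_simps)
    have dy: "y - - (x - y - w) = d" by (simp add: d_def)
    have "((\<lambda>h. (heat h x - x) /\<^sub>R h - (heat h w - w) /\<^sub>R h) \<longlongrightarrow> y - - (x - y - w)) (at_right 0)"
      by (intro tendsto_diff xy heat_difference_quotient Hw)
    then have "((\<lambda>h. inner ((heat h d - d) /\<^sub>R h) d) \<longlongrightarrow> inner d d) (at_right 0)"
      unfolding quot dy by (intro tendsto_inner tendsto_const)
    moreover have "\<forall>\<^sub>F h in at_right 0. inner ((heat h d - d) /\<^sub>R h) d \<le> 0"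
      using eventually_at_right_less[of "0::real"]
    proof eventually_elim
      case (elim h)
      have "inner (heat h d) d \<le> norm (heat h d) * norm d" by (rule norm_cauchy_schwarz)
      also have "\<dots> \<le> norm d * norm d"
        using order_trans[OF norm_blinfun mult_right_mono[OF norm_heat_le norm_ge_zero], of h d]
        by (intro mult_right_mono) auto
      finally show ?case using elim
        by (simp add: inner_simps dot_square_norm power2_eq_square mult_nonneg_nonpos)
    qed
    ultimately have "inner d d \<le> 0" by (rule tendsto_upperbound) simp
    then have "x = w" by (simp add: d_def) (metis inner_ge_zero inner_eq_zero_iff order_antisym eq_iff_diff_eq_0)
    then show "(x, y) \<in> uminus_op H" using Hw by (force simp: uminus_op_def)
  qed
qed

text \<open>
  Every semigroup \<open>U\<close> generated by \<open>- H\<close> commutes with \<open>R\<close> and so with every \<open>heat r\<close>. For small \<open>s\<close> and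
  \<open>h = s / n\<close>, telescoping the \<open>n\<close>-th powers bounds \<open>norm (U s x - heat s x)\<close> by a constant times
  \<open>s\<close> times the norm of the difference of the difference quotients at step \<open>h\<close>, which tends to 0 for
  \<open>x\<close> in the domain.
\<close>

lemma semigroup_unique:
  assumes U: "C0_semigroup U" and gen: "generator U = uminus_op H" and t: "0 \<le> t"
  shows "U t = heat t"
proof -
  have UR: "U s o\<^sub>L R = R o\<^sub>L U s" if "0 \<le> s" for s
  proof (rule blinfun_eqI)
    fix u
    have "(R u, - (u - R u)) \<in> generator U"
      unfolding gen uminus_op_def using R_mem by blast
    from generator_invariant[OF U this that] have "(U s (R u), U s u - U s (R u)) \<in> H"
      unfolding gen uminus_op_def
      by (auto simp: blinfun.bilinear_simps) (metis minus_diff_eq minus_minus)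
    from R_apply[OF this] show "(U s o\<^sub>L R) u = (R o\<^sub>L U s) u" by simp
  qed
  have comm: "U s (heat r x) = heat r (U s x)" if "0 \<le> s" for s r x
  proof -
    have "U s o\<^sub>L heat r = heat r o\<^sub>L U s"
      using fun_op_commute[OF R_unit_op continuous_heat_fun UR[OF that], of r] by (simp add: heat_def)
    then show ?thesis by (metis blinfun_apply_blinfun_compose)
  qed
  obtain \<delta> M where \<delta>: "0 < \<delta>" and M: "\<And>s. 0 \<le> s \<Longrightarrow> s \<le> \<delta> \<Longrightarrow> norm (U s) \<le> M"
    using C0_semigroup_locally_bounded[OF U] by metis
  have "0 \<le> M" using M[of 0] \<delta> by (smt (verit) norm_ge_zero)
  have tele: "norm (U (real n * h) x - heat (real n * h) x) \<le> real n * (M * norm (U h x - heat h x))"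
    if h: "0 \<le> h" and nh: "real n * h \<le> \<delta>" for n :: nat and h x
    using nh
  proof (induction n arbitrary: x)
    case 0
    have "U 0 = heat 0" using U C0_semigroup_heat by (simp add: C0_semigroup_def)
    then show ?case by simp
  next
    case (Suc n)
    have nh: "real n * h \<le> \<delta>" using Suc.prems h by (simp add: algebra_simps)
    have "U (real (Suc n) * h) x - heat (real (Suc n) * h) x
        = U (real n * h) (U h x - heat h x) + (U (real n * h) (heat h x) - heat (real n * h) (heat h x))"
      unfolding C0_semigroup_multiple[OF U h] C0_semigroup_multiple[OF C0_semigroup_heat h]
      by (simp add: blinfun.bilinear_simps)
    then have "norm (U (real (Suc n) * h) x - heat (real (Suc n) * h) x)
        \<le> norm (U (real n * h) (U h x - heat h x)) + norm (U (real n * h) (heat h x) - heat (real n * h) (heat h x))"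
      by (simp only: norm_triangle_ineq)
    also have "norm (U (real n * h) (U h x - heat h x)) \<le> M * norm (U h x - heat h x)"
      using M[OF _ nh] h by (intro order_trans[OF norm_blinfun mult_right_mono]) auto
    also have "norm (U (real n * h) (heat h x) - heat (real n * h) (heat h x))
        \<le> real n * (M * norm (U h x - heat h x))"
    proof (rule order_trans[OF Suc.IH[OF nh]])
      have "norm (U h (heat h x) - heat h (heat h x)) \<le> norm (U h x - heat h x)"
      proof -
        have "U h (heat h x) - heat h (heat h x) = heat h (U h x - heat h x)"
          by (simp add: comm[OF h] blinfun.bilinear_simps)
        also have "norm \<dots> \<le> 1 * norm (U h x - heat h x)"
          by (rule order_trans[OF norm_blinfun mult_right_mono[OF norm_heat_le]]) simp
        finally show ?thesis by simp
      qed
      then show "real n * (M * norm (U h (heat h x) - heat h (heat h x)))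
          \<le> real n * (M * norm (U h x - heat h x))"
        using \<open>0 \<le> M\<close> by (intro mult_left_mono) auto
    qed
    finally show ?case by (simp add: algebra_simps)
  qed
  have U0: "U 0 = heat 0" using U C0_semigroup_heat by (simp add: C0_semigroup_def)
  have small: "U s = heat s" if s: "0 < s" "s \<le> \<delta>" for s
  proof -
    have "U s x = heat s x" if x: "x \<in> Domain H" for x
    proof -
      obtain y where xy: "(x, y) \<in> H" using x by auto
      define q where "q h = (U h x - x) /\<^sub>R h - (heat h x - x) /\<^sub>R h" for h
      have "((\<lambda>h. (U h x - x) /\<^sub>R h) \<longlongrightarrow> - y) (at_right 0)"
        using gen xy by (auto simp: generator_def uminus_op_def)
      from tendsto_diff[OF this heat_difference_quotient[OF xy]]
      have q: "(q \<longlongrightarrow> 0) (at_right 0)" by (simp add: q_def[abs_def])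
      have "filterlim (\<lambda>n. s / real (Suc n)) (at_right 0) sequentially"
        using s by real_asymp
      from filterlim_compose[OF q this]
      have lim: "(\<lambda>n. M * (s * norm (q (s / real (Suc n))))) \<longlonglongrightarrow> 0"
        by (intro tendsto_mult_right_zero tendsto_norm_zero)
      have "norm (U s x - heat s x) \<le> M * (s * norm (q (s / real (Suc n))))" for n
      proof -
        define h where "h = s / real (Suc n)"
        have h: "0 < h" "real (Suc n) * h = s" using s by (auto simp: h_def)
        have "h *\<^sub>R q h = U h x - heat h x"
          using h(1) by (simp add: q_def scaleR_diff_right)
        then have "norm (h *\<^sub>R q h) = norm (U h x - heat h x)" by (rule arg_cong)
        then have e1: "h * norm (q h) = norm (U h x - heat h x)"
          using h(1) by simp
        have e2: "norm (U s x - heat s x) \<le> real (Suc n) * (M * norm (U h x - heat h x))"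
          using tele[of h "Suc n" x] h s by simp
        have "norm (U s x - heat s x) \<le> M * ((real (Suc n) * h) * norm (q h))"
          using e2 unfolding e1[symmetric] by (simp only: mult_ac)
        then have "norm (U s x - heat s x) \<le> M * (s * norm (q h))" unfolding h(2) .
        then show ?thesis unfolding h_def .
      qed
      then have "norm (U s x - heat s x) \<le> 0"
        by (intro LIMSEQ_le_const[OF lim]) simp
      then show ?thesis by simp
    qed
    note dom = this
    have "((\<lambda>n::nat. U s x) \<longlongrightarrow> heat s x) sequentially" for x
    proof (rule tendsto_on_dense[OF _ Domain_dense, where M = "norm (U s)"])
      fix z assume "z \<in> Domain H"
      then show "((\<lambda>n::nat. U s z) \<longlongrightarrow> heat s z) sequentially" using dom by simp
    qed simp
    then show ?thesis by (intro blinfun_eqI) (simp add: LIMSEQ_const_iff)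
  qed
  obtain n :: nat where n: "t / \<delta> < n" using reals_Archimedean2 by blast
  define h where "h = t / n"
  have "0 < n" 
  proof -
    have "0 \<le> t / \<delta>" using t \<delta> by simp
    then show ?thesis using n by linarith
  qed
  then have nh: "real n * h = t" by (simp add: h_def)
  have "0 \<le> h" using t by (simp add: h_def)
  have "h \<le> \<delta>" using n \<open>0 < n\<close> \<delta> by (simp add: h_def field_simps)
  have "U h = heat h"
  proof (cases "h = 0")
    case True
    then show ?thesis using U0 by simp
  next
    case False
    then show ?thesis using small \<open>0 \<le> h\<close> \<open>h \<le> \<delta>\<close> by simp
  qed
  have "U (real m * h) = heat (real m * h)" for m
  proof (induction m)
    case 0
    then show ?case using U0 by simp
  next
    case (Suc m)
    then show ?case
      unfolding C0_semigroup_multiple[OF U \<open>0 \<le> h\<close>] C0_semigroup_multiple[OF C0_semigroup_heat \<open>0 \<le> h\<close>]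
      by (simp add: \<open>U h = heat h\<close>)
  qed
  from this[of n] show ?thesis unfolding nh .
qed

lemma exp_op_eq_heat:
  assumes "0 \<le> t" shows "exp_op (uminus_op H) t = heat t"
  unfolding exp_op_def
proof (rule the_equality)
  show "\<exists>U. C0_semigroup U \<and> generator U = uminus_op H \<and> heat t = U t"
    using C0_semigroup_heat generator_heat by blast
  show "T = heat t" if "\<exists>U. C0_semigroup U \<and> generator U = uminus_op H \<and> T = U t" for T
    using that semigroup_unique assms by (elim exE conjE) simp
qed

end

section \<open>Contractions close to the identity\<close>

lemma blinfun_pow_Suc: "blinfun_pow T (Suc n) = T o\<^sub>L blinfun_pow T n"
  by (simp add: blinfun_pow_def)

lemma blinfun_pow_eq_fun_op:
  assumes A: "unit_op A"
  shows "blinfun_pow A n = fun_op A (\<lambda>x. x ^ n)"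
proof (induction n)
  case 0
  then show ?case using fun_op_const[OF A, of 1] by (simp add: blinfun_pow_def)
next
  case (Suc n)
  have "continuous_on {0..1} (\<lambda>x::real. x ^ n)" by (intro continuous_intros)
  from fun_op_mult[OF A continuous_on_id this] show ?case
    by (simp add: blinfun_pow_Suc Suc fun_op_ident[OF A])
qed

lemma norm_blinfun_pow_le:
  fixes A :: "'a::{real_inner,banach} \<Rightarrow>\<^sub>L 'a"
  assumes A: "unit_op A"
  shows "norm (blinfun_pow A n) \<le> 1"
  unfolding blinfun_pow_eq_fun_op[OF A]
  by (rule fun_op_norm_le[OF A]) (auto intro!: continuous_intros simp: power_le_one)

text \<open>
  The function that takes \<open>F \<tau>\<close> to the resolvent \<open>(1 + S \<tau>)\<inverse>\<close>.
\<close>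

definition resolvent_fun :: "real \<Rightarrow> real \<Rightarrow> real" where
  "resolvent_fun \<tau> x = 1 / (1 + (1 - x) / \<tau>)"

lemma resolvent_fun_pos: "0 < \<tau> \<Longrightarrow> x \<in> {0..1} \<Longrightarrow> 0 < resolvent_fun \<tau> x"
  by (simp add: resolvent_fun_def add_pos_nonneg)

lemma resolvent_fun_in_unit: "0 < \<tau> \<Longrightarrow> x \<in> {0..1} \<Longrightarrow> resolvent_fun \<tau> x \<in> {0..1}"
  using resolvent_fun_pos[of \<tau> x] by (simp add: resolvent_fun_def)

lemma continuous_resolvent_fun:
  assumes "0 < \<tau>" shows "continuous_on {0..1} (resolvent_fun \<tau>)"
proof -
  have "1 + (1 - x) / \<tau> \<noteq> 0" if "x \<in> {0..1}" for x
    using resolvent_fun_pos[OF assms that] by (auto simp: resolvent_fun_def)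
  then show ?thesis unfolding resolvent_fun_def using assms by (intro continuous_intros) auto
qed

lemma resolvent_S_op:
  assumes A: "unit_op (F \<tau>)" "F \<tau> \<in> bounded_ops" and \<tau>: "0 < \<tau>"
  shows "inverse_op (one_plus_op (op_graph (S_op F \<tau>))) = fun_op (F \<tau>) (resolvent_fun \<tau>)"
proof (rule inverse_op_eqI)
  let ?A = "F \<tau>"
  let ?B = "fun_op ?A (resolvent_fun \<tau>)"
  let ?g = "\<lambda>x::real. 1 + (1 / \<tau>) * (1 - x)"
  have c1: "continuous_on {0..1} (\<lambda>x::real. 1 - x)" by (intro continuous_intros)
  have c2: "continuous_on {0..1} (\<lambda>x. (1 / \<tau>) * (1 - x))" by (intro continuous_intros)
  have c: "continuous_on {0..1} ?g" by (intro continuous_intros)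
  have g: "fun_op ?A ?g = id_blinfun + S_op F \<tau>"
    unfolding fun_op_add[OF A(1) continuous_on_const c2] fun_op_scaleR[OF A(1) c1]
      fun_op_diff[OF A(1) continuous_on_const continuous_on_id] fun_op_const[OF A(1)] fun_op_ident[OF A(1)]
    by (simp add: S_op_def divide_inverse)
  have inv: "?g x * resolvent_fun \<tau> x = 1" if "x \<in> {0..1}" for x
    using resolvent_fun_pos[OF \<tau> that] by (auto simp: resolvent_fun_def)
  have "fun_op ?A (\<lambda>x. ?g x * resolvent_fun \<tau> x) = fun_op ?A (\<lambda>_. 1)"
    "fun_op ?A (\<lambda>x. resolvent_fun \<tau> x * ?g x) = fun_op ?A (\<lambda>_. 1)"
    by (rule fun_op_cong, use inv in \<open>simp add: mult.commute\<close>)+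
  then have "(id_blinfun + S_op F \<tau>) o\<^sub>L ?B = id_blinfun" "?B o\<^sub>L (id_blinfun + S_op F \<tau>) = id_blinfun"
    unfolding fun_op_mult[OF A(1) c continuous_resolvent_fun[OF \<tau>]]
      fun_op_mult[OF A(1) continuous_resolvent_fun[OF \<tau>] c] g fun_op_const[OF A(1)] by simp_all
  then have "?B x + S_op F \<tau> (?B x) = x" "?B (x + S_op F \<tau> x) = x" for x
    by (metis blinfun_apply_blinfun_compose blinfun_apply_id_blinfun plus_blinfun.rep_eq)+
  then show "op_graph ?B = (one_plus_op (op_graph (S_op F \<tau>)))\<inverse>"
    unfolding op_graph_def one_plus_op_def by auto
  show "?B \<in> bounded_ops"
    by (rule fun_op_bounded_ops[OF A continuous_resolvent_fun[OF \<tau>]])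
qed

text \<open>
  With \<open>v = 1 - x\<close> and \<open>g = exp (- v)\<close>, the difference \<open>g\<^sup>n - x\<^sup>n\<close> is at most
  \<open>n g\<^sup>n\<^sup>-\<^sup>1 (g - x) \<le> n exp (- (n - 1) v) v\<^sup>2\<close>, which is of order \<open>1 / n\<close> because \<open>y\<^sup>2 exp (- y)\<close> is bounded.
\<close>

lemma power_exp_dist_le:
  fixes x :: real
  assumes x: "x \<in> {0..1}" and n: "0 < n"
  shows "\<bar>x ^ n - exp (- real n * (1 - x))\<bar> \<le> 6 / real n"
proof -
  define v where "v = 1 - x"
  define g where "g = exp (- v)"
  have v: "0 \<le> v" "v \<le> 1" using x by (auto simp: v_def)
  have xg: "x \<le> g" and gx: "g - x \<le> v\<^sup>2"
    using exp_minus_bounds[OF v(1)] by (auto simp: g_def v_def)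
  obtain m where m: "n = Suc m" using n by (metis gr0_implies_Suc)
  have "g ^ Suc m - x ^ Suc m \<le> real (Suc m) * (g ^ m * (g - x))" for m
  proof (induction m)
    case (Suc m)
    have "g ^ Suc (Suc m) - x ^ Suc (Suc m) = g * (g ^ Suc m - x ^ Suc m) + x ^ Suc m * (g - x)"
      by (simp add: algebra_simps)
    also have "\<dots> \<le> g * (real (Suc m) * (g ^ m * (g - x))) + g ^ Suc m * (g - x)"
      using x xg by (intro add_mono mult_left_mono mult_right_mono Suc.IH power_mono) (auto simp: g_def)
    finally show ?case by (simp add: algebra_simps)
  qed simp
  then have "g ^ n - x ^ n \<le> n * (g ^ m * (g - x))" using m by blast
  also have "\<dots> \<le> n * (g ^ m * v\<^sup>2)"
    using gx by (intro mult_left_mono) (auto simp: g_def)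
  also have "g ^ m = exp v * exp (- (n * v))"
    by (simp add: g_def m exp_of_nat_mult[symmetric] exp_add[symmetric] algebra_simps)
  also have "n * (exp v * exp (- (n * v)) * v\<^sup>2) = exp v * ((n * v)\<^sup>2 * exp (- (n * v))) / n"
    using n by (simp add: power2_eq_square field_simps)
  also have "\<dots> \<le> 3 * 2 / n"
  proof (intro divide_right_mono mult_mono)
    have "exp v \<le> exp 1" using v by simp
    then show "exp v \<le> 3" using exp_le by linarith
    have nv: "0 \<le> n * v" using v(1) by simp
    have "(n * v)\<^sup>2 \<le> 2 * exp (n * v)"
      using exp_lower_Taylor_quadratic[OF nv] nv by linarith
    then show "(n * v)\<^sup>2 * exp (- (n * v)) \<le> 2"
      by (simp add: exp_minus field_simps)
  qed auto
  finally have "g ^ n - x ^ n \<le> 6 / n" by simp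
  moreover have "x ^ n \<le> g ^ n" using x xg by (intro power_mono) auto
  moreover have "exp (- real n * (1 - x)) = g ^ n"
    by (simp add: g_def v_def exp_of_nat_mult[symmetric] algebra_simps)
  ultimately show ?thesis by simp
qed

text \<open>
  For \<open>A = F \<tau>\<close> the second operator is \<open>exp (- n \<tau> S \<tau>)\<close>, that is, \<open>exp (- n (1 - A))\<close>: a Chernoff
  estimate whose rate \<open>1 / n\<close> rests on self-adjointness and does not involve \<open>\<tau>\<close>.
\<close>

lemma blinfun_pow_heat_dist_le:
  assumes A: "unit_op A" and n: "0 < n" and \<tau>: "0 < \<tau>"
  shows "norm (blinfun_pow A n - fun_op (fun_op A (resolvent_fun \<tau>)) (heat_fun (real n * \<tau>))) \<le> 6 / real n"
proof -
  have nt: "0 < real n * \<tau>" using n \<tau> by simp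
  have c: "continuous_on {0..1} (\<lambda>x. heat_fun (real n * \<tau>) (resolvent_fun \<tau> x))"
    by (rule continuous_on_compose2[OF continuous_heat_fun[OF nt] continuous_resolvent_fun[OF \<tau>]])
      (use resolvent_fun_in_unit[OF \<tau>] in auto)
  have "continuous_on {0..1} (\<lambda>x::real. x ^ n)" by (intro continuous_intros)
  moreover have "\<bar>x ^ n - heat_fun (real n * \<tau>) (resolvent_fun \<tau> x)\<bar> \<le> 6 / n" if x: "x \<in> {0..1}" for x
  proof -
    have "heat_fun (real n * \<tau>) (resolvent_fun \<tau> x) = exp (- real n * (1 - x))"
      using resolvent_fun_pos[OF \<tau> x] \<tau> by (simp add: heat_fun_def) (simp add: resolvent_fun_def)
    then show ?thesis using power_exp_dist_le[OF x n] by simp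
  qed
  ultimately have "norm (fun_op A (\<lambda>x. x ^ n)
      - fun_op A (\<lambda>x. heat_fun (real n * \<tau>) (resolvent_fun \<tau> x))) \<le> 6 / n"
    using fun_op_dist_le[OF A _ c] by blast
  moreover have "fun_op (fun_op A (resolvent_fun \<tau>)) (heat_fun (real n * \<tau>))
      = fun_op A (\<lambda>x. heat_fun (real n * \<tau>) (resolvent_fun \<tau> x))"
    by (rule fun_op_comp[OF A continuous_resolvent_fun[OF \<tau>] continuous_heat_fun[OF nt]])
      (rule resolvent_fun_in_unit[OF \<tau>])
  ultimately show ?thesis by (simp add: blinfun_pow_eq_fun_op[OF A])
qed

section \<open>Convergence of the exponentials and of the resolvents\<close>

lemma heat_fun_lipschitz:
  assumes a: "0 < a" "a \<le> s" "a \<le> t" and r: "r \<in> {0..1}"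
  shows "\<bar>heat_fun s r - heat_fun t r\<bar> \<le> \<bar>s - t\<bar> / a"
proof -
  have le: "\<bar>heat_fun s r - heat_fun t r\<bar> \<le> (t - s) / a" if "a \<le> s" "s \<le> t" for s t
  proof (cases "r = 0")
    case True
    then show ?thesis using that a(1) by (simp add: heat_fun_def)
  next
    case False
    then have "0 < r" using r by simp
    define u where "u = 1 / r - 1"
    have u: "0 \<le> u" using r \<open>0 < r\<close> by (simp add: u_def)
    have "heat_fun s r - heat_fun t r = exp (- (s * u)) * (1 - exp (- ((t - s) * u)))"
      using \<open>0 < r\<close> by (simp add: heat_fun_def u_def[symmetric] right_diff_distrib exp_add[symmetric] algebra_simps)
    moreover have "0 \<le> 1 - exp (- ((t - s) * u))" using u that by simp
    ultimately have "\<bar>heat_fun s r - heat_fun t r\<bar> = exp (- (s * u)) * (1 - exp (- ((t - s) * u)))"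
      by simp
    also have "\<dots> \<le> exp (- (s * u)) * ((t - s) * u)"
      using exp_minus_bounds(1)[of "(t - s) * u"] u that by (intro mult_left_mono) auto
    also have "\<dots> = (s * u) * exp (- (s * u)) * ((t - s) / s)"
      using a(1) that by simp
    also have "\<dots> \<le> 1 * ((t - s) / a)"
    proof (intro mult_mono)
      have "s * u \<le> exp (s * u)" using exp_ge_add_one_self[of "s * u"] by linarith
      then show "s * u * exp (- (s * u)) \<le> 1" by (simp add: exp_minus field_simps)
      show "(t - s) / s \<le> (t - s) / a" using that a(1) by (intro divide_left_mono) auto
    qed (use that a(1) in auto)
    finally show ?thesis by simp
  qed
  show ?thesis
    using le[of s t] le[of t s] a by (cases "s \<le> t") (auto simp: abs_minus_commute)
qed

lemma fun_op_heat_fun_lipschitz: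
  assumes "unit_op A" "0 < a" "a \<le> s" "a \<le> t"
  shows "norm (fun_op A (heat_fun s) - fun_op A (heat_fun t)) \<le> \<bar>s - t\<bar> / a"
  using assms by (intro fun_op_dist_le continuous_heat_fun heat_fun_lipschitz) auto

text \<open>
  At each single time this is continuity of the functional calculus. The Lipschitz estimate
  in \<open>t\<close>, uniform over operators, reduces the interval to a finite net.
\<close>

lemma fun_op_heat_fun_uniform:
  fixes A :: "'a::{real_inner,banach} \<Rightarrow>\<^sub>L 'a"
  assumes lim: "(B \<longlongrightarrow> A) G" and A: "unit_op A" and B: "\<forall>\<^sub>F \<tau> in G. unit_op (B \<tau>)"
    and a: "0 < a" and e: "0 < e"
  shows "\<forall>\<^sub>F \<tau> in G. \<forall>t\<in>{a..b}. norm (fun_op (B \<tau>) (heat_fun t) - fun_op A (heat_fun t)) < e"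
proof -
  define d where "d = e * a / 3"
  have "0 < d" using a e by (simp add: d_def)
  obtain K where K: "finite K" "K \<subseteq> {a..b}" "{a..b} \<subseteq> (\<Union>s\<in>K. ball s d)"
    using compactE_image[OF compact_Icc[of a b], of "{a..b}" "\<lambda>s. ball s d"] \<open>0 < d\<close> by force
  have "\<forall>\<^sub>F \<tau> in G. \<forall>s\<in>K. norm (fun_op (B \<tau>) (heat_fun s) - fun_op A (heat_fun s)) < e / 3"
  proof (intro eventually_ball_finite ballI K(1))
    fix s assume "s \<in> K"
    then have "0 < s" using K(2) a by auto
    from tendstoD[OF fun_op_continuous[OF lim A B continuous_heat_fun[OF this]], of "e / 3"]
    show "\<forall>\<^sub>F \<tau> in G. norm (fun_op (B \<tau>) (heat_fun s) - fun_op A (heat_fun s)) < e / 3"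
      using e by (simp add: dist_norm)
  qed
  with B show ?thesis
  proof eventually_elim
    case (elim \<tau>)
    show ?case
    proof
      fix t assume t: "t \<in> {a..b}"
      then obtain s where s: "s \<in> K" "\<bar>s - t\<bar> < d" using K(3) by (force simp: dist_real_def)
      have st: "a \<le> s" "a \<le> t" using s K(2) t by auto
      have "\<bar>s - t\<bar> / a < e / 3" using s(2) a by (simp add: d_def field_simps)
      moreover have tri: "norm (p - q) \<le> norm (p' - p) + norm (p' - q') + norm (q' - q)"
        for p q p' q' :: "'a \<Rightarrow>\<^sub>L 'a"
        using norm_triangle_ineq[of "p' - q'" "q' - q"] norm_triangle_ineq4[of "p' - q" "p' - p"] by simp
      ultimately show "norm (fun_op (B \<tau>) (heat_fun t) - fun_op A (heat_fun t)) < e"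
        using fun_op_heat_fun_lipschitz[OF elim(1) a st] fun_op_heat_fun_lipschitz[OF A a st]
          bspec[OF elim(2) s(1)]
          tri[of "fun_op (B \<tau>) (heat_fun t)" "fun_op A (heat_fun t)"
            "fun_op (B \<tau>) (heat_fun s)" "fun_op A (heat_fun s)"]
        by linarith
    qed
  qed
qed

text \<open>
  The inverse of \<open>heat_fun 1\<close>: with \<open>u = exp (- \<lambda>)\<close> its value is \<open>1 / (1 + \<lambda>)\<close>. The absolute value
  only keeps the denominator positive for \<open>u > 1\<close>.
\<close>

definition log_resolvent_fun :: "real \<Rightarrow> real" where
  "log_resolvent_fun u = (if u \<le> 0 then 0 else 1 / (1 + \<bar>ln u\<bar>))"

lemma continuous_log_resolvent_fun: "continuous_on {0..1} log_resolvent_fun"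
  unfolding log_resolvent_fun_def[abs_def]
proof (rule continuous_on_extend_by_zero)
  show "continuous_on {0<..} (\<lambda>u::real. 1 / (1 + \<bar>ln u\<bar>))"
    by (intro continuous_intros) (auto simp: add_nonneg_eq_0_iff)
  show "((\<lambda>u::real. 1 / (1 + \<bar>ln u\<bar>)) \<longlongrightarrow> 0) (at_right 0)" by real_asymp
qed

lemma fun_op_log_resolvent_fun:
  assumes A: "unit_op A"
  shows "fun_op (fun_op A (heat_fun 1)) log_resolvent_fun = A"
proof -
  have "fun_op (fun_op A (heat_fun 1)) log_resolvent_fun = fun_op A (\<lambda>r. log_resolvent_fun (heat_fun 1 r))"
    by (intro fun_op_comp A continuous_heat_fun continuous_log_resolvent_fun heat_fun_in_unit) auto
  also have "\<dots> = fun_op A (\<lambda>r. r)"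
    by (rule fun_op_cong) (auto simp: heat_fun_def log_resolvent_fun_def field_simps)
  finally show ?thesis by (simp add: fun_op_ident[OF A])
qed

text \<open>
  The exponentials at the one time \<open>t = 1\<close> already determine the resolvents continuously in norm.
\<close>

lemma tendsto_of_heat_tendsto:
  fixes A :: "'a::{real_inner,banach} \<Rightarrow>\<^sub>L 'a"
  assumes lim: "((\<lambda>\<tau>. fun_op (B \<tau>) (heat_fun 1)) \<longlongrightarrow> fun_op A (heat_fun 1)) G"
    and A: "unit_op A" and B: "\<forall>\<^sub>F \<tau> in G. unit_op (B \<tau>)"
  shows "(B \<longlongrightarrow> A) G"
proof -
  have unit: "unit_op (fun_op T (heat_fun 1))" if "unit_op T" for T :: "'a \<Rightarrow>\<^sub>L 'a"
    by (intro unit_op_fun_op that continuous_heat_fun heat_fun_in_unit) auto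
  have "((\<lambda>\<tau>. fun_op (fun_op (B \<tau>) (heat_fun 1)) log_resolvent_fun) \<longlongrightarrow> A) G"
    using fun_op_continuous[OF lim unit[OF A] eventually_mono[OF B unit] continuous_log_resolvent_fun]
    by (simp add: fun_op_log_resolvent_fun[OF A])
  then show ?thesis
    by (rule Lim_transform_eventually)
      (use B in \<open>eventually_elim, simp add: fun_op_log_resolvent_fun\<close>)
qed

theorem theorem2p3:
  fixes F :: "real \<Rightarrow> ('a::complex_hilbert \<Rightarrow>\<^sub>L 'a)"
    and H :: "'a operator"
  assumes F_bounded: "\<And>t. t \<ge> 0 \<Longrightarrow> F t \<in> bounded_ops"
    and F_measurable: "weakly_measurable {0..} F"
    and F_self_adjoint: "\<And>t. t \<ge> 0 \<Longrightarrow> self_adjoint (op_graph (F t))"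
    and F_nonneg: "\<And>t. t \<ge> 0 \<Longrightarrow> nonneg_op (op_graph (F t))"
    and F_contraction: "\<And>t. t \<ge> 0 \<Longrightarrow> norm (F t) \<le> 1"
    and F_0: "F 0 = id_blinfun"
    and H_self_adjoint: "self_adjoint H"
    and H_nonneg: "nonneg_op H"
    and strong_resolvent_limit:
      "limitin strong_operator_topology
         (\<lambda>\<tau>. inverse_op (one_plus_op (op_graph (S_op F \<tau>))))
         (inverse_op (one_plus_op H)) (at_right 0)"
  shows "(\<forall>a b. 0 < a \<and> a < b \<longrightarrow>
            (\<lambda>n. SUP t\<in>{a..b}.
               norm (blinfun_pow (F (t / real n)) n - exp_op (uminus_op H) t)) \<longlonglongrightarrow> 0)
     \<longleftrightarrow>
     ((\<lambda>\<tau>. norm (inverse_op (one_plus_op (op_graph (S_op F \<tau>)))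
                - inverse_op (one_plus_op H))) \<longlongrightarrow> 0) (at_right 0)"
proof -
  interpret nonneg_self_adjoint H by standard (fact H_self_adjoint, fact H_nonneg)
  define B where "B \<tau> = inverse_op (one_plus_op (op_graph (S_op F \<tau>)))" for \<tau>
  define D where "D n t = norm (blinfun_pow (F (t / real n)) n - exp_op (uminus_op H) t)" for n t
  have unit_F: "unit_op (F t)" if t: "0 \<le> t" for t
  proof (rule unit_opI)
    fix x y
    have graph: "(z, F t z) \<in> op_graph (F t)" for z by (auto simp: op_graph_def)
    show "inner (F t x) y = inner x (F t y)"
      using self_adjoint_symmetric[OF F_self_adjoint[OF t] graph graph, of y x] by (simp add: inner_commute)
    show "0 \<le> inner x (F t x)"
      by (rule nonneg_op_inner[OF F_nonneg[OF t] graph])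
    have "norm (F t x) \<le> 1 * norm x"
      by (rule order_trans[OF norm_blinfun mult_right_mono[OF F_contraction[OF t]]]) simp
    then show "norm (F t x) \<le> norm x" by simp
  qed
  have B_eq: "B \<tau> = fun_op (F \<tau>) (resolvent_fun \<tau>)" if "0 < \<tau>" for \<tau>
    unfolding B_def using that by (intro resolvent_S_op unit_F F_bounded) auto
  have unit_B: "unit_op (B \<tau>)" if "0 < \<tau>" for \<tau>
    unfolding B_eq[OF that] using that
    by (intro unit_op_fun_op unit_F continuous_resolvent_fun resolvent_fun_in_unit) auto
  have unit_B_ev: "\<forall>\<^sub>F \<tau> in at_right 0. unit_op (B \<tau>)"
    using eventually_at_right_less[of "0::real"] by eventually_elim (rule unit_B)
  have chernoff: "norm (blinfun_pow (F \<tau>) n - fun_op (B \<tau>) (heat_fun (real n * \<tau>))) \<le> 6 / real n"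
    if "0 < \<tau>" "0 < n" for \<tau> n
    unfolding B_eq[OF that(1)] using that by (intro blinfun_pow_heat_dist_le unit_F) auto
  have exp_eq: "exp_op (uminus_op H) t = fun_op R (heat_fun t)" if "0 < t" for t
    using that by (simp add: exp_op_eq_heat heat_eq)
  have D_bound: "D n t \<le> 2" if "0 < t" for n t
  proof -
    have "norm (blinfun_pow (F (t / real n)) n) \<le> 1"
      using that by (intro norm_blinfun_pow_le unit_F) auto
    moreover have "norm (exp_op (uminus_op H) t) \<le> 1"
      using that norm_heat_le[of t] by (simp add: exp_op_eq_heat)
    ultimately show ?thesis
      using norm_triangle_ineq4[of "blinfun_pow (F (t / real n)) n" "exp_op (uminus_op H) t"]
      unfolding D_def by linarith
  qed
  have bdd: "bdd_above (D n ` {a..b})" if "0 < a" for n and a b :: real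
    using D_bound that by (intro bdd_aboveI[where M = 2]) auto
  have D_nonneg: "0 \<le> D n t" for n t by (simp add: D_def)
  have resolvent_iff: "((\<lambda>\<tau>. norm (inverse_op (one_plus_op (op_graph (S_op F \<tau>)))
      - inverse_op (one_plus_op H))) \<longlongrightarrow> 0) (at_right 0) \<longleftrightarrow> (B \<longlongrightarrow> R) (at_right 0)"
    unfolding B_def[symmetric] R_def[symmetric] tendsto_norm_zero_iff LIM_zero_iff ..
  show ?thesis
    unfolding resolvent_iff D_def[symmetric]
  proof
    assume unif: "\<forall>a b. 0 < a \<and> a < b \<longrightarrow> (\<lambda>n. SUP t\<in>{a..b}. D n t) \<longlonglongrightarrow> 0"
    show "(B \<longlongrightarrow> R) (at_right 0)"
    proof (rule tendsto_of_heat_tendsto[OF _ R_unit_op unit_B_ev])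
      show "((\<lambda>\<tau>. fun_op (B \<tau>) (heat_fun 1)) \<longlongrightarrow> fun_op R (heat_fun 1)) (at_right 0)"
      proof (rule tendstoI)
        fix e :: real assume e: "0 < e"
        have "(\<lambda>n. SUP t\<in>{1..2}. D n t) \<longlonglongrightarrow> 0" using unif by auto
        from order_tendstoD(2)[OF this, of "e / 2"] e
        obtain N where N: "\<And>n. N \<le> n \<Longrightarrow> (SUP t\<in>{1..2}. D n t) < e / 2"
          by (auto simp: eventually_sequentially)
        have D_small: "D n t < e / 2" if "N \<le> n" "t \<in> {1..2}" for n t
          by (rule le_less_trans[OF cSUP_upper[OF that(2) bdd] N[OF that(1)]]) simp
        \<comment> \<open>the errors below add up to less than \<open>6 \<tau> + \<tau> + \<tau> + e / 2\<close>\<close>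
        define d where "d = min (min 1 (1 / real (Suc N))) (e / 16)"
        have "0 < d" using e by (simp add: d_def)
        have "dist (fun_op (B \<tau>) (heat_fun 1)) (fun_op R (heat_fun 1)) < e"
          if \<tau>: "0 < \<tau>" "\<tau> < d" for \<tau>
        proof -
          \<comment> \<open>every small \<open>\<tau>\<close> is of the form \<open>t / n\<close> with \<open>t\<close> within \<open>\<tau>\<close> of 1 and \<open>n\<close> large\<close>
          define n where "n = nat \<lceil>1 / \<tau>\<rceil>"
          define t where "t = real n * \<tau>"
          have "1 / \<tau> \<le> n" "n < 1 / \<tau> + 1"
            using \<tau>(1) by (auto simp: n_def) linarith+
          then have t: "1 \<le> t" "t < 1 + \<tau>"
            using \<tau>(1) by (auto simp: t_def field_simps)
          have "\<tau> < 1" "\<tau> < 1 / real (Suc N)" "\<tau> < e / 16" using \<tau>(2) unfolding d_def min_less_iff_conj by blast+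
          have "real (Suc N) < 1 / \<tau>"
            using \<open>\<tau> < 1 / real (Suc N)\<close> \<tau>(1) by (simp add: field_simps)
          then have "real (Suc N) < n" using \<open>1 / \<tau> \<le> n\<close> by linarith
          then have n: "N \<le> n" "0 < n" by linarith+
          have "t / real n = \<tau>" using n by (simp add: t_def)
          have "6 / n \<le> 6 * \<tau>" using \<open>1 / \<tau> \<le> n\<close> \<tau>(1) n by (simp add: field_simps)
          have 1: "norm (blinfun_pow (F \<tau>) n - fun_op (B \<tau>) (heat_fun t)) \<le> 6 * \<tau>"
            using chernoff[OF \<tau>(1) n(2)] \<open>6 / n \<le> 6 * \<tau>\<close> unfolding t_def by linarith
          have 2: "norm (blinfun_pow (F \<tau>) n - fun_op R (heat_fun t)) < e / 2"
            using D_small[OF n(1), of t] t \<open>\<tau> < 1\<close> \<open>t / real n = \<tau>\<close> by (simp add: D_def exp_eq)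
          have 3: "norm (fun_op (B \<tau>) (heat_fun t) - fun_op (B \<tau>) (heat_fun 1)) \<le> \<tau>"
            "norm (fun_op R (heat_fun t) - fun_op R (heat_fun 1)) \<le> \<tau>"
            using fun_op_heat_fun_lipschitz[OF unit_B[OF \<tau>(1)], of 1 t 1]
              fun_op_heat_fun_lipschitz[OF R_unit_op, of 1 t 1] t by auto
          have "norm (q - r) \<le> norm (p' - q) + norm (u - p') + norm (u - r') + norm (r' - r)"
            for p' q r r' u :: "'a \<Rightarrow>\<^sub>L 'a"
            using norm_triangle_ineq4[of "u - p'" "u - r'"] norm_triangle_ineq4[of "r' - p'" "r' - r"]
              norm_triangle_ineq4[of "p' - q" "p' - r"]
              norm_minus_commute[of "p'" "r'"] norm_minus_commute[of "p'" "r"]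
              norm_minus_commute[of q r] by simp
          from this[of "fun_op (B \<tau>) (heat_fun 1)" "fun_op R (heat_fun 1)"
              "fun_op (B \<tau>) (heat_fun t)" "blinfun_pow (F \<tau>) n" "fun_op R (heat_fun t)"]
          show ?thesis using 1 2 3 \<open>\<tau> < e / 16\<close> unfolding dist_norm by linarith
        qed
        then show "\<forall>\<^sub>F \<tau> in at_right 0. dist (fun_op (B \<tau>) (heat_fun 1)) (fun_op R (heat_fun 1)) < e"
          unfolding eventually_at_right_field using \<open>0 < d\<close> by blast
      qed
    qed
  next
    assume lim: "(B \<longlongrightarrow> R) (at_right 0)"
    show "\<forall>a b. 0 < a \<and> a < b \<longrightarrow> (\<lambda>n. SUP t\<in>{a..b}. D n t) \<longlonglongrightarrow> 0"
    proof (intro allI impI, elim conjE)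
      fix a b :: real assume ab: "0 < a" "a < b"
      show "(\<lambda>n. SUP t\<in>{a..b}. D n t) \<longlonglongrightarrow> 0"
      proof (rule LIMSEQ_I)
        fix e :: real assume e: "0 < e"
        then have "0 < e / 3" by simp
        from fun_op_heat_fun_uniform[OF lim R_unit_op unit_B_ev ab(1) this, of b]
        obtain d where d: "0 < d" "\<forall>\<tau>>0. \<tau> < d \<longrightarrow> (\<forall>t\<in>{a..b}.
            norm (fun_op (B \<tau>) (heat_fun t) - fun_op R (heat_fun t)) < e / 3)"
          unfolding eventually_at_right_field by (elim exE conjE)
        obtain N :: nat where N: "max (b / d) (18 / e) < N" using reals_Archimedean2 by blast
        show "\<exists>N. \<forall>n\<ge>N. norm ((SUP t\<in>{a..b}. D n t) - 0) < e"
        proof (intro exI allI impI)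
          fix n assume "N \<le> n"
          then have "real N \<le> real n" by simp
          then have n: "b / d < n" "18 / e < n" using N unfolding max_less_iff_conj by linarith+
          have "0 < 18 / e" using e by simp
          then have "0 < n" using n(2) by linarith
          have le: "D n t \<le> 2 * e / 3" if t: "t \<in> {a..b}" for t
          proof -
            define \<tau> where "\<tau> = t / real n"
            have nt: "real n * \<tau> = t" "0 < \<tau>" using \<open>0 < n\<close> t ab by (simp_all add: \<tau>_def)
            have "b < real n * d" using n(1) d(1) by (simp add: pos_divide_less_eq)
            then have "t < d * real n" using t by (simp add: mult.commute)
            then have "\<tau> < d" using \<open>0 < n\<close> by (simp add: \<tau>_def pos_divide_less_eq)
            have "6 / n < e / 3" using n(2) e \<open>0 < n\<close> by (simp add: field_simps)
            moreover have "D n t = norm (blinfun_pow (F \<tau>) n - fun_op R (heat_fun t))"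
              using t ab by (simp add: D_def \<tau>_def exp_eq)
            moreover have "norm (blinfun_pow (F \<tau>) n - fun_op R (heat_fun t))
                \<le> norm (blinfun_pow (F \<tau>) n - fun_op (B \<tau>) (heat_fun t))
                  + norm (fun_op (B \<tau>) (heat_fun t) - fun_op R (heat_fun t))"
              by (rule norm_diff_triangle_le[OF order_refl order_refl])
            ultimately show ?thesis
              using chernoff[OF nt(2) \<open>0 < n\<close>, unfolded nt(1)] d(2)[rule_format, OF nt(2) \<open>\<tau> < d\<close> t]
              by linarith
          qed
          have "(SUP t\<in>{a..b}. D n t) \<le> 2 * e / 3"
            using ab le by (intro cSUP_least) auto
          moreover have "0 \<le> (SUP t\<in>{a..b}. D n t)"
            using ab by (intro cSUP_upper2[OF bdd[OF ab(1)], of a] D_nonneg) auto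
          ultimately show "norm ((SUP t\<in>{a..b}. D n t) - 0) < e" using e by simp
        qed
      qed
    qed
  qed
qed

end
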